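(* For every integer $n\geq 2$, the Artinian graded $F$-algebra $R_n/K_n$, of codimension $n$, is Gorenstein.
   Context: $F$ is an algebraically closed field of characteristic $0$, and $R_n=F[x_1,\ldots,x_n]$ with its standard grading ($\deg x_i=1$). For $n\geq 3$, $I_n\lhd R_n$ is the ideal generated by the $n$ polynomials $\left(\prod_{j\neq i}x_j\right)-x_i$, $1\leq i\leq n$; for $n=2$ one sets $I_2=\langle x_1,x_2\rangle\lhd F[x_1,x_2]$. $K_n=\mathrm{in}_{\mathrm{Gr}}(I_n)\lhd R_n$ is the homogeneous ideal generated by the highest-degree homogeneous components of all nonzero elements of $I_n$. The quotient $R_n/K_n$ is finite-dimensional over $F$; "codimension $n$" refers to the codimension of $\mathrm{Spec}\,R_n/K_n$ in affine $n$-space $\mathrm{Spec}\,R_n$. *)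

theory Defs
  imports
    "HOL-Algebra.Algebra"
    "HOL-Computational_Algebra.Polynomial"
    "HOL-Library.Poly_Mapping"
    "HOL-Library.Extended_Nat"
begin

section \<open>Polynomials in finitely many variables\<close>

text \<open>
  A monomial is a finitely supported exponent vector and a polynomial a finitely supported
  family of coefficients; the ring structure on the type is the convolution product of
  \<^theory>\<open>HOL-Library.Poly_Mapping\<close>. The ring of polynomials in the variables with indices
  \<open>1, \<dots>, n\<close> is carved out by a carrier, since \<open>n\<close> is a number and not a type.
\<close>

type_synonym 'a mpoly = "(nat \<Rightarrow>\<^sub>0 nat) \<Rightarrow>\<^sub>0 'a"

definition Var :: "nat \<Rightarrow> 'a::comm_ring_1 mpoly" where
  "Var i = Poly_Mapping.single (Poly_Mapping.single i 1) 1"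

definition mpoly_ring :: "nat \<Rightarrow> 'a::comm_ring_1 mpoly ring" where
  "mpoly_ring n =
     \<lparr>carrier = {p. \<forall>m \<in> Poly_Mapping.keys p. Poly_Mapping.keys m \<subseteq> {1..n}},
      monoid.mult = (*), one = 1, ring.zero = 0, add = (+)\<rparr>"

definition monom_degree :: "(nat \<Rightarrow>\<^sub>0 nat) \<Rightarrow> nat" where
  "monom_degree m = (\<Sum>i \<in> Poly_Mapping.keys m. Poly_Mapping.lookup m i)"

definition hom_component :: "nat \<Rightarrow> 'a::comm_ring_1 mpoly \<Rightarrow> 'a mpoly" where
  "hom_component d p =
     (\<Sum>m \<in> {m \<in> Poly_Mapping.keys p. monom_degree m = d}.
        Poly_Mapping.single m (Poly_Mapping.lookup p m))"

text \<open>The next two are only meaningful for nonzero polynomials.\<close>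

definition total_degree :: "'a::comm_ring_1 mpoly \<Rightarrow> nat" where
  "total_degree p = Max (monom_degree ` Poly_Mapping.keys p)"

definition leading_form :: "'a::comm_ring_1 mpoly \<Rightarrow> 'a mpoly" where
  "leading_form p = hom_component (total_degree p) p"

definition homogeneous_ideal :: "nat \<Rightarrow> 'a::comm_ring_1 mpoly set \<Rightarrow> bool" where
  "homogeneous_ideal n J \<longleftrightarrow>
     ideal J (mpoly_ring n) \<and> (\<forall>p \<in> J. \<forall>d. hom_component d p \<in> J)"

lemma Var_in_mpoly_ring: "i \<in> {1..n} \<Longrightarrow> Var i \<in> carrier (mpoly_ring n)"
  by (auto simp: mpoly_ring_def Var_def)

lemma cring_mpoly_ring: "cring (mpoly_ring n :: 'a::comm_ring_1 mpoly ring)"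
proof -
  let ?C = "{p :: 'a mpoly. \<forall>m \<in> Poly_Mapping.keys p. Poly_Mapping.keys m \<subseteq> {1..n}}"
  have plus: "p + q \<in> ?C" if "p \<in> ?C" "q \<in> ?C" for p q
    using that Poly_Mapping.keys_add[of p q] by blast
  have times: "p * q \<in> ?C" if p: "p \<in> ?C" and q: "q \<in> ?C" for p q
  proof (rule CollectI, rule ballI)
    fix m assume "m \<in> Poly_Mapping.keys (p * q)"
    then obtain a b where ab: "a \<in> Poly_Mapping.keys p" "b \<in> Poly_Mapping.keys q" "m = a + b"
      using keys_mult[of p q] by blast
    have "Poly_Mapping.keys a \<subseteq> {1..n}" "Poly_Mapping.keys b \<subseteq> {1..n}"
      using ab p q by blast+
    then show "Poly_Mapping.keys m \<subseteq> {1..n}"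
      using ab(3) Poly_Mapping.keys_add[of a b] by blast
  qed
  have uminus: "- p \<in> ?C" if "p \<in> ?C" for p
    using that by simp
  have car: "carrier (mpoly_ring n) = ?C" and ops: "monoid.mult (mpoly_ring n) = ((*) :: 'a mpoly \<Rightarrow> _)"
    "add (mpoly_ring n) = ((+) :: 'a mpoly \<Rightarrow> _)" "monoid.one (mpoly_ring n) = (1 :: 'a mpoly)"
    "ring.zero (mpoly_ring n) = (0 :: 'a mpoly)"
    by (simp_all add: mpoly_ring_def)
  have zero_one: "0 \<in> ?C" "1 \<in> ?C"
    by simp_all
  show ?thesis
  proof (rule cringI)
    show "abelian_group (mpoly_ring n :: 'a mpoly ring)"
    proof (rule abelian_groupI, unfold car ops)
      show "\<exists>q \<in> ?C. q + p = 0" if "p \<in> ?C" for p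
        using uminus[OF that] by (intro bexI[of _ "- p"]) simp_all
    qed (rule plus zero_one add.assoc add.commute add_0_left; assumption?)+
    show "comm_monoid (mpoly_ring n :: 'a mpoly ring)"
      by (rule comm_monoidI, unfold car ops)
        (rule times zero_one mult.assoc mult.commute mult_1_left; assumption?)+
  qed (unfold ops, rule distrib_right)
qed

section \<open>The ideals \<open>I\<^sub>n\<close> and \<open>K\<^sub>n\<close>\<close>

definition I_generators :: "nat \<Rightarrow> 'a::comm_ring_1 mpoly set" where
  "I_generators n =
     (if n = 2 then {Var 1, Var 2}
      else (\<lambda>i. (\<Prod>j \<in> {1..n} - {i}. Var j) - Var i) ` {1..n})"

definition I_ideal :: "nat \<Rightarrow> 'a::comm_ring_1 mpoly set" where
  "I_ideal n = Idl\<^bsub>mpoly_ring n\<^esub> (I_generators n)"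

definition initial_ideal :: "nat \<Rightarrow> 'a::comm_ring_1 mpoly set \<Rightarrow> 'a mpoly set" where
  "initial_ideal n J = Idl\<^bsub>mpoly_ring n\<^esub> (leading_form ` (J - {0}))"

definition K_ideal :: "nat \<Rightarrow> 'a::comm_ring_1 mpoly set" where
  "K_ideal n = initial_ideal n (I_ideal n)"

section \<open>Notions from commutative algebra\<close>

definition artinian_ring :: "('a, 'b) ring_scheme \<Rightarrow> bool" where
  "artinian_ring R \<longleftrightarrow> cring R \<and>
     (\<forall>J :: nat \<Rightarrow> 'a set. (\<forall>i. ideal (J i) R) \<and> (\<forall>i. J (Suc i) \<subseteq> J i)
        \<longrightarrow> (\<exists>m. \<forall>i \<ge> m. J i = J m))"

text \<open>
  The codimension of the closed subscheme of \<open>Spec R\<close> cut out by \<open>J\<close> is the infimum, over the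
  primes \<open>P\<close> containing \<open>J\<close>, of the supremum of the lengths of chains of primes ending in \<open>P\<close>.
  For \<open>J = R\<close> it is infinite.
\<close>

definition prime_height :: "('a, 'b) ring_scheme \<Rightarrow> 'a set \<Rightarrow> enat" where
  "prime_height R P =
     Sup {enat k | k. \<exists>Q :: nat \<Rightarrow> 'a set. (\<forall>i \<le> k. primeideal (Q i) R) \<and>
                        (\<forall>i < k. Q i \<subset> Q (Suc i)) \<and> Q k = P}"

definition codimension :: "('a, 'b) ring_scheme \<Rightarrow> 'a set \<Rightarrow> enat" where
  "codimension R J = Inf {prime_height R P | P. primeideal P R \<and> J \<subseteq> P}"

text \<open>
  An Artinian local ring \<open>(R, M)\<close> is Gorenstein if its socle \<open>(0 : M)\<close> has dimension one over
  the residue field \<open>R/M\<close>. As \<open>M\<close> kills the socle, the \<open>R/M\<close>-span of an element \<open>s\<close> of the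
  socle is \<open>{r s | r \<in> R}\<close>, so dimension one says that the socle is of this form with \<open>s \<noteq> 0\<close>.
\<close>

definition socle :: "('a, 'b) ring_scheme \<Rightarrow> 'a set \<Rightarrow> 'a set" where
  "socle R M = {a \<in> carrier R. \<forall>x \<in> M. x \<otimes>\<^bsub>R\<^esub> a = \<zero>\<^bsub>R\<^esub>}"

definition gorenstein_artinian_local :: "('a, 'b) ring_scheme \<Rightarrow> bool" where
  "gorenstein_artinian_local R \<longleftrightarrow>
     artinian_ring R \<and>
     (\<exists>M. maximalideal M R \<and> (\<forall>M'. maximalideal M' R \<longrightarrow> M' = M) \<and>
        (\<exists>s \<in> socle R M. s \<noteq> \<zero>\<^bsub>R\<^esub> \<and> socle R M = {r \<otimes>\<^bsub>R\<^esub> s | r. r \<in> carrier R}))"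

end

theory Submission
  imports Defs
begin

text \<open>
  Put \<open>D = 2 (n - 2)\<close> and let \<open>\<phi>\<close> be the linear form on \<open>R\<^sub>n\<close> that adds up the coefficients of
  those monomials of degree \<open>D\<close> in which all exponents are even. The proof is Macaulay duality
  with this explicit \<open>\<phi>\<close>: if \<open>A\<close> denotes the ideal of all \<open>p\<close> with \<open>\<phi> (p q) = 0\<close> for every \<open>q\<close>,
  then \<open>K\<^sub>n = A\<close> (\<open>K_ideal_eq_annihilator\<close>), and the theorem follows from the description of \<open>A\<close>.

  For \<open>K\<^sub>n \<subseteq> A\<close>, the form \<open>\<phi>\<close> is the part in degree \<open>D\<close> of a linear form \<open>\<lambda>\<close> that vanishes on \<open>I\<^sub>n\<close>.
  Modulo \<open>I\<^sub>n\<close> all squares \<open>x\<^sub>i\<^sup>2\<close> coincide with one element \<open>t\<close>, and \<open>\<lambda>\<close> reads off the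
  coefficient of \<open>t\<^sup>n\<^sup>-\<^sup>2\<close> in a normal form. It can be written without normal forms: \<open>\<lambda>\<close> is
  \<open>1\<close> on the monomials for which some \<open>e \<ge> 1\<close> makes the degree \<open>(n - 2) e\<close> and all exponents congruent
  to \<open>e\<close> modulo \<open>2\<close>, and \<open>0\<close> on the others. Replacing a factor \<open>x\<^sub>i\<close> by the product of the other variables raises the
  degree by \<open>n - 2\<close> and flips every parity, so \<open>\<lambda>\<close> vanishes on \<open>I\<^sub>n\<close> for \<open>n \<ge> 3\<close>;
  for \<open>n = 2\<close> it is the constant term, which vanishes on \<open>I\<^sub>2\<close>. In degrees up
  to \<open>D\<close> the forms \<open>\<lambda>\<close> and \<open>\<phi>\<close> agree; hence \<open>\<phi> (l m) = \<lambda> (f m) = 0\<close> when \<open>l\<close> is the leading form of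
  \<open>f \<in> I\<^sub>n\<close> and the monomial \<open>m\<close> fills the degree up to \<open>D\<close>.

  For \<open>A \<subseteq> K\<^sub>n\<close>, the forms \<open>x\<^sub>i\<^sup>2 - x\<^sub>j\<^sup>2\<close> and the products of \<open>n - 1\<close> distinct variables lie in \<open>K\<^sub>n\<close>. Modulo the
  former, a monomial depends only on the set \<open>S\<close> of its odd exponents and on its degree
  \<open>card S + 2 k\<close>. If \<open>card S + k \<ge> n - 1\<close>, one monomial of the class is divisible by a product of \<open>n - 1\<close>
  variables; otherwise some monomial pairs under \<open>\<phi>\<close> with exactly this class, so that the
  coefficients of an element of \<open>A\<close> add up to \<open>0\<close> over the class.

  Since \<open>\<phi>\<close> lives in a single degree, \<open>A\<close> is homogeneous and contains all monomials of degree
  above \<open>D\<close>. So the quotient is finite-dimensional, hence Artinian, and the ideal of the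
  origin is the only prime over \<open>A\<close>. If \<open>p\<close> is killed by that ideal modulo \<open>A\<close>, then
  \<open>\<phi> (p q)\<close> depends only on the constant term of \<open>q\<close>, as it does for multiples of \<open>x\<^sub>1\<^sup>D\<close>; therefore \<open>x\<^sub>1\<^sup>D\<close> spans
  the socle.

  The codimension is the height of the ideal of the origin. The coordinate ideals give a chain of length \<open>n\<close>. A longer
  chain \<open>Q\<^sub>0 \<subset> Q\<^sub>1 \<subset> \<dots>\<close> would provide more than \<open>n\<close> polynomials \<open>y\<^sub>i \<in> Q\<^sub>i\<^sub>+\<^sub>1 - Q\<^sub>i\<close>; they are algebraically
  dependent, and splitting off the lowest powers of \<open>y\<^sub>0, y\<^sub>1, \<dots>\<close> in a relation one after the other forces a nonzero
  constant into the last prime.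
\<close>

section \<open>Polynomials, ideals and linear forms\<close>

abbreviation lookup :: "('a \<Rightarrow>\<^sub>0 'b::zero) \<Rightarrow> 'a \<Rightarrow> 'b" where "lookup \<equiv> Poly_Mapping.lookup"
abbreviation keys :: "('a \<Rightarrow>\<^sub>0 'b::zero) \<Rightarrow> 'a set" where "keys \<equiv> Poly_Mapping.keys"
abbreviation mon :: "(nat \<Rightarrow>\<^sub>0 nat) \<Rightarrow> 'a::comm_ring_1 mpoly" where "mon m \<equiv> Poly_Mapping.single m 1"
abbreviation const :: "'a \<Rightarrow> 'a::comm_ring_1 mpoly" where "const c \<equiv> Poly_Mapping.single 0 c"

definition exponents :: "nat \<Rightarrow> (nat \<Rightarrow>\<^sub>0 nat) set" where
  "exponents n = {m. keys m \<subseteq> {1..n}}"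

lemma zero_in_exponents [simp]: "0 \<in> exponents n"
  by (simp add: exponents_def)

lemma keys_add_nat: "keys (a + b) = keys a \<union> keys (b :: nat \<Rightarrow>\<^sub>0 nat)"
  by (auto simp: in_keys_iff lookup_add)

lemma add_in_exponents_iff [simp]: "a + b \<in> exponents n \<longleftrightarrow> a \<in> exponents n \<and> b \<in> exponents n"
  by (simp add: exponents_def keys_add_nat)

lemma single_in_exponents: "Poly_Mapping.single i k \<in> exponents n \<longleftrightarrow> k = 0 \<or> i \<in> {1..n}"
  by (simp add: exponents_def)

lemma mpoly_ring_simps [simp]:
  "p \<otimes>\<^bsub>mpoly_ring n\<^esub> q = p * q" "p \<oplus>\<^bsub>mpoly_ring n\<^esub> q = p + q"
  "\<one>\<^bsub>mpoly_ring n\<^esub> = 1" "\<zero>\<^bsub>mpoly_ring n\<^esub> = 0"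
  by (simp_all add: mpoly_ring_def)

lemma carrier_mpoly_ring: "carrier (mpoly_ring n) = {p. keys p \<subseteq> exponents n}"
  by (auto simp: mpoly_ring_def exponents_def)

lemma single_in_carrier: "m \<in> exponents n \<Longrightarrow> Poly_Mapping.single m c \<in> carrier (mpoly_ring n)"
  by (auto simp: carrier_mpoly_ring)

lemma const_in_carrier: "const c \<in> carrier (mpoly_ring n)"
  by (auto simp: carrier_mpoly_ring)

lemma zero_in_carrier: "0 \<in> carrier (mpoly_ring n)"
  and one_in_carrier: "1 \<in> carrier (mpoly_ring n)"
  by (auto simp: carrier_mpoly_ring)

lemma mult_in_carrier:
  "p \<in> carrier (mpoly_ring n) \<Longrightarrow> q \<in> carrier (mpoly_ring n) \<Longrightarrow> p * q \<in> carrier (mpoly_ring n)"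
  for p q :: "'a::comm_ring_1 mpoly"
  using monoid.m_closed[OF ring.is_monoid[OF cring.axioms(1)[OF cring_mpoly_ring]]] by force

lemma add_in_carrier:
  "p \<in> carrier (mpoly_ring n) \<Longrightarrow> q \<in> carrier (mpoly_ring n) \<Longrightarrow> p + q \<in> carrier (mpoly_ring n)"
  using Poly_Mapping.keys_add[of p q] unfolding carrier_mpoly_ring by blast

lemma mpoly_ring_a_inv:
  assumes "p \<in> carrier (mpoly_ring n)"
  shows "\<ominus>\<^bsub>mpoly_ring n\<^esub> p = - (p :: 'a::comm_ring_1 mpoly)"
proof -
  interpret cring "mpoly_ring n :: 'a mpoly ring" by (rule cring_mpoly_ring)
  have "- p \<in> carrier (mpoly_ring n)" using assms by (simp add: carrier_mpoly_ring)
  then show ?thesis using minus_equality[of "- p" p] assms by simp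
qed

lemma ideal_mpoly_ringI:
  assumes "J \<subseteq> carrier (mpoly_ring n)" "0 \<in> J"
    and "\<And>p q. p \<in> J \<Longrightarrow> q \<in> J \<Longrightarrow> p + q \<in> J"
    and mul: "\<And>p q. p \<in> J \<Longrightarrow> q \<in> carrier (mpoly_ring n) \<Longrightarrow> q * p \<in> J"
  shows "ideal (J :: 'a::comm_ring_1 mpoly set) (mpoly_ring n)"
proof -
  interpret cring "mpoly_ring n :: 'a mpoly ring" by (rule cring_mpoly_ring)
  have "- p \<in> J" if "p \<in> J" for p
    using mul[OF that, of "- 1"] by (auto simp: carrier_mpoly_ring)
  then have "subgroup J (add_monoid (mpoly_ring n :: 'a mpoly ring))"
    using assms
    by (intro add.subgroupI) (auto simp: mpoly_ring_a_inv simp flip: a_inv_def)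
  then show ?thesis
    using mul by (intro idealI ring_axioms) (simp_all add: mult.commute)
qed

context
  fixes J :: "'a::comm_ring_1 mpoly set" and n :: nat
  assumes J: "ideal J (mpoly_ring n)"
begin

lemma ideal_subset_carrier: "J \<subseteq> carrier (mpoly_ring n)"
  using J by (rule additive_subgroup.a_subset[OF ideal.axioms(1)])

lemma ideal_zero: "0 \<in> J"
  using additive_subgroup.zero_closed[OF ideal.axioms(1)[OF J]] by simp

lemma ideal_add: "p \<in> J \<Longrightarrow> q \<in> J \<Longrightarrow> p + q \<in> J"
  using additive_subgroup.a_closed[OF ideal.axioms(1)[OF J]] by force

lemma ideal_mult: "p \<in> J \<Longrightarrow> q \<in> carrier (mpoly_ring n) \<Longrightarrow> q * p \<in> J"
  using ideal.I_l_closed[OF J] by force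

lemma ideal_uminus: "p \<in> J \<Longrightarrow> - p \<in> J"
  using ideal_mult[of p "- 1"] by (simp add: carrier_mpoly_ring)

lemma ideal_diff: "p \<in> J \<Longrightarrow> q \<in> J \<Longrightarrow> p - q \<in> J"
  using ideal_add[of p "- q"] ideal_uminus[of q] by simp

lemma ideal_sum: "(\<And>x. x \<in> S \<Longrightarrow> f x \<in> J) \<Longrightarrow> sum f S \<in> J"
  by (induction S rule: infinite_finite_induct) (auto intro: ideal_zero ideal_add)

lemma ideal_scale: "mon m \<in> J \<Longrightarrow> Poly_Mapping.single m c \<in> J"
  using ideal_mult[of "mon m" "const c"] by (simp add: mult_single const_in_carrier)

end

lemma sum_monomials: "(\<Sum>m\<in>keys p. Poly_Mapping.single m (lookup p m)) = p"
  by (rule poly_mapping_eqI) (simp add: lookup_sum lookup_single when_def in_keys_iff)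

text \<open>
  A linear form on polynomials is given by its values \<open>w\<close> on monomials.
\<close>

definition linform :: "((nat \<Rightarrow>\<^sub>0 nat) \<Rightarrow> 'a) \<Rightarrow> 'a::comm_ring_1 mpoly \<Rightarrow> 'a" where
  "linform w p = (\<Sum>m\<in>keys p. lookup p m * w m)"

lemma linform_superset:
  "finite S \<Longrightarrow> keys p \<subseteq> S \<Longrightarrow> linform w p = (\<Sum>m\<in>S. lookup p m * w m)"
  unfolding linform_def by (rule sum.mono_neutral_left) (auto simp: in_keys_iff)

lemma linform_0 [simp]: "linform w 0 = 0"
  by (simp add: linform_def)

lemma linform_single [simp]: "linform w (Poly_Mapping.single m c) = c * w m"
  by (simp add: linform_def)

lemma linform_add: "linform w (p + q) = linform w p + linform w q"
proof -
  have "keys (p + q) \<subseteq> keys p \<union> keys q" by (rule Poly_Mapping.keys_add)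
  then show ?thesis
    by (simp add: linform_superset[of "keys p \<union> keys q"] lookup_add distrib_right sum.distrib)
qed

lemma linform_sum: "linform w (sum f S) = (\<Sum>x\<in>S. linform w (f x))"
  by (induction S rule: infinite_finite_induct) (simp_all add: linform_add)

lemma linform_uminus: "linform w (- p) = - linform w p"
  using linform_add[of w p "- p"] by (simp add: eq_neg_iff_add_eq_0 add.commute)

lemma linform_diff: "linform w (p - q) = linform w p - linform w q"
  using linform_add[of w p "- q"] by (simp add: linform_uminus)

lemma linform_mult:
  "linform w (p * q) = (\<Sum>m\<in>keys q. lookup q m * linform (\<lambda>a. w (a + m)) p)"
proof -
  have "p * q = (\<Sum>a\<in>keys p. \<Sum>m\<in>keys q. Poly_Mapping.single (a + m) (lookup p a * lookup q m))"
    by (subst (1 2) sum_monomials[symmetric]) (simp add: sum_product mult_single)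
  then have "linform w (p * q) = (\<Sum>a\<in>keys p. \<Sum>m\<in>keys q. lookup p a * lookup q m * w (a + m))"
    by (simp add: linform_sum)
  also have "\<dots> = (\<Sum>m\<in>keys q. \<Sum>a\<in>keys p. lookup p a * lookup q m * w (a + m))"
    by (rule sum.swap)
  finally show ?thesis by (simp add: linform_def sum_distrib_left mult_ac)
qed

text \<open>
  This is the largest ideal on which the linear form given by \<open>w\<close> vanishes, so the kernel
  of the pairing \<open>(p, q) \<mapsto> linform w (p * q)\<close>. By linearity in \<open>q\<close> it suffices to test monomials \<open>q\<close>, which
  keeps the condition a statement about the coefficients of \<open>p\<close>.
\<close>

definition annihilator :: "nat \<Rightarrow> ((nat \<Rightarrow>\<^sub>0 nat) \<Rightarrow> 'a) \<Rightarrow> 'a::comm_ring_1 mpoly set" where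
  "annihilator n w = {p \<in> carrier (mpoly_ring n). \<forall>m \<in> exponents n. linform (\<lambda>a. w (a + m)) p = 0}"

lemma linform_annihilator_mult:
  assumes "p \<in> annihilator n w" "q \<in> carrier (mpoly_ring n)"
  shows "linform w (p * q) = 0"
  unfolding linform_mult using assms
  by (intro sum.neutral) (auto simp: annihilator_def carrier_mpoly_ring)

lemma linform_shift: "linform (\<lambda>a. w (a + m)) p = linform w (p * mon m)"
  by (simp add: linform_mult)

lemma ideal_annihilator: "ideal (annihilator n w :: 'a::comm_ring_1 mpoly set) (mpoly_ring n)"
proof (rule ideal_mpoly_ringI)
  fix p q :: "'a mpoly" assume p: "p \<in> annihilator n w" and q: "q \<in> carrier (mpoly_ring n)"
  have pc: "p \<in> carrier (mpoly_ring n)" using p by (simp add: annihilator_def)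
  have "linform (\<lambda>a. w (a + m)) (q * p) = 0" if "m \<in> exponents n" for m
    unfolding linform_shift
    using linform_annihilator_mult[OF p mult_in_carrier[OF q single_in_carrier[OF that]]] by (simp add: mult_ac)
  then show "q * p \<in> annihilator n w"
    using mult_in_carrier[OF q pc] by (auto simp: annihilator_def)
next
  fix p q assume "p \<in> annihilator n w" "q \<in> annihilator n w"
  then show "p + q \<in> annihilator n w"
    by (auto simp: annihilator_def linform_add intro: add_in_carrier)
qed (auto simp: annihilator_def carrier_mpoly_ring)

section \<open>A linear form vanishing on \<open>I\<^sub>n\<close>\<close>

lemma monom_degree_superset:
  "finite S \<Longrightarrow> keys m \<subseteq> S \<Longrightarrow> monom_degree m = (\<Sum>i\<in>S. lookup m i)"
  unfolding monom_degree_def by (rule sum.mono_neutral_left) (auto simp: in_keys_iff)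

lemma monom_degree_exponents:
  "m \<in> exponents n \<Longrightarrow> monom_degree m = (\<Sum>i\<in>{1..n}. lookup m i)"
  by (simp add: monom_degree_superset exponents_def)

lemma monom_degree_add: "monom_degree (a + b) = monom_degree a + monom_degree b"
  by (simp add: monom_degree_superset[of "keys a \<union> keys b"] keys_add_nat lookup_add sum.distrib)

lemma monom_degree_single [simp]: "monom_degree (Poly_Mapping.single i k) = k"
  by (simp add: monom_degree_def)

lemma monom_degree_eq_0: "monom_degree m = 0 \<longleftrightarrow> m = 0"
  by (auto simp: monom_degree_def in_keys_iff intro: poly_mapping_eqI)

definition sqfree :: "nat set \<Rightarrow> (nat \<Rightarrow>\<^sub>0 nat)" where
  "sqfree S = (\<Sum>i\<in>S. Poly_Mapping.single i 1)"

lemma lookup_sqfree: "finite S \<Longrightarrow> lookup (sqfree S) i = of_bool (i \<in> S)"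
  by (simp add: sqfree_def lookup_sum lookup_single when_def)

lemma keys_sqfree: "finite S \<Longrightarrow> keys (sqfree S) = S"
  by (auto simp: in_keys_iff lookup_sqfree)

lemma monom_degree_sqfree: "finite S \<Longrightarrow> monom_degree (sqfree S) = card S"
  by (simp add: monom_degree_def keys_sqfree lookup_sqfree)

lemma prod_Var: "(\<Prod>i\<in>S. Var i) = mon (sqfree S)"
  by (induction S rule: infinite_finite_induct) (simp_all add: sqfree_def Var_def mult_single)

text \<open>
  The values on monomials of the form \<open>\<lambda>\<close> that vanishes on \<open>I\<^sub>n\<close>. Trading a factor \<open>x\<^sub>i\<close> for the
  product of the other variables raises \<open>e\<close> by one. The bound \<open>e \<ge> 1\<close> makes \<open>\<lambda>\<close> vanish in all degrees below
  \<open>2 (n - 2)\<close>: for \<open>n \<ge> 3\<close> it excludes the monomial \<open>1\<close>, where \<open>e\<close> would be \<open>0\<close>.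
\<close>

definition affine_weight :: "nat \<Rightarrow> (nat \<Rightarrow>\<^sub>0 nat) \<Rightarrow> 'a::comm_ring_1" where
  "affine_weight n m = of_bool (\<exists>e\<ge>1. monom_degree m = (n - 2) * e \<and>
     (\<forall>i\<in>{1..n}. even (lookup m i + e)))"

text \<open>
  The part of the previous form in degree \<open>2 (n - 2)\<close>; the dual generator of \<open>R\<^sub>n / K\<^sub>n\<close>.
\<close>

definition top_weight :: "nat \<Rightarrow> (nat \<Rightarrow>\<^sub>0 nat) \<Rightarrow> 'a::comm_ring_1" where
  "top_weight n m = of_bool (monom_degree m = 2 * (n - 2) \<and> (\<forall>i\<in>{1..n}. even (lookup m i)))"

text \<open>
  For \<open>n \<ge> 3\<close> only \<open>e = 1\<close> and \<open>e = 2\<close> are possible in this range of degrees, and \<open>e = 1\<close> would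
  require \<open>n\<close> odd exponents with sum \<open>n - 2\<close>.
\<close>

lemma affine_weight_eq_top_weight:
  assumes "m \<in> exponents n" "n \<ge> 2" "monom_degree m \<le> 2 * (n - 2)"
  shows "affine_weight n m = top_weight n m"
proof (cases "n = 2")
  case True
  then have "m = 0" using assms(3) by (simp add: monom_degree_eq_0)
  moreover have "\<exists>e::nat. e \<ge> 1 \<and> even e" by (rule exI[of _ 2]) simp
  ultimately show ?thesis using True by (auto simp: affine_weight_def top_weight_def monom_degree_def)
next
  case False
  have e2: "e = 2" if e: "e \<ge> 1" "monom_degree m = (n - 2) * e" "\<forall>i\<in>{1..n}. even (lookup m i + e)" for e
  proof (rule ccontr)
    assume "e \<noteq> 2"
    have "(n - 2) * e \<le> (n - 2) * 2" using e(2) assms(3) by (simp add: mult.commute)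
    with False assms(2) have "e \<le> 2" by simp
    with \<open>e \<noteq> 2\<close> e(1) have "e = 1" by simp
    then have "lookup m i \<ge> 1" if "i \<in> {1..n}" for i
      using bspec[OF e(3) that] \<open>e = 1\<close> by (cases "lookup m i") auto
    then have "(\<Sum>i\<in>{1..n}. 1) \<le> (\<Sum>i\<in>{1..n}. lookup m i)" by (intro sum_mono) auto
    then show False using e(2) \<open>e = 1\<close> assms(1,2) by (simp add: monom_degree_exponents)
  qed
  have "(\<exists>e\<ge>1. monom_degree m = (n - 2) * e \<and> (\<forall>i\<in>{1..n}. even (lookup m i + e))) \<longleftrightarrow>
     monom_degree m = 2 * (n - 2) \<and> (\<forall>i\<in>{1..n}. even (lookup m i))" (is "?L \<longleftrightarrow> ?R")
  proof (intro iffI)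
    assume ?L
    then obtain e where "monom_degree m = (n - 2) * e" "\<forall>i\<in>{1..n}. even (lookup m i + e)" "e = 2"
      using e2 by blast
    then show ?R by simp
  next
    assume ?R
    then show ?L by (intro exI[of _ 2]) simp
  qed
  then show ?thesis unfolding affine_weight_def top_weight_def by simp
qed

text \<open>
  The two monomials differ in degree by \<open>n - 2\<close> and have opposite parities throughout, so that
  \<open>e\<close> fits the right-hand side if and only if \<open>e + 1\<close> fits the left-hand side.
\<close>

lemma affine_weight_generator:
  assumes n: "n \<ge> 3" and i: "i \<in> {1..n}"
  shows "affine_weight n (sqfree ({1..n} - {i}) + m) = affine_weight n (Poly_Mapping.single i 1 + m)"
proof -
  let ?u = "sqfree ({1..n} - {i}) + m" and ?v = "Poly_Mapping.single i 1 + m"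
  have deg: "monom_degree ?u = monom_degree ?v + (n - 2)"
    using n i by (simp add: monom_degree_add monom_degree_sqfree)
  have pos: "monom_degree ?v > 0" by (simp add: monom_degree_add)
  have parity: "even (lookup ?u k + Suc e) \<longleftrightarrow> even (lookup ?v k + e)" if "k \<in> {1..n}" for k e
    using that by (auto simp: lookup_add lookup_sqfree lookup_single when_def)
  have "(\<exists>e\<ge>1. monom_degree ?u = (n - 2) * e \<and> (\<forall>k\<in>{1..n}. even (lookup ?u k + e))) \<longleftrightarrow>
    (\<exists>e\<ge>1. monom_degree ?v = (n - 2) * e \<and> (\<forall>k\<in>{1..n}. even (lookup ?v k + e)))" (is "?L \<longleftrightarrow> ?R")
  proof
    assume ?L
    then obtain e where e: "e \<ge> 1" "monom_degree ?u = (n - 2) * e"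
      "\<forall>k\<in>{1..n}. even (lookup ?u k + e)" by blast
    then obtain f where f: "e = Suc f" by (cases e) auto
    have "monom_degree ?v = (n - 2) * f" using e(2) deg f by simp
    moreover from this pos have "f \<ge> 1" by (cases f) auto
    moreover have "\<forall>k\<in>{1..n}. even (lookup ?v k + f)" using e(3) parity f by blast
    ultimately show ?R by blast
  next
    assume ?R
    then obtain f where f: "monom_degree ?v = (n - 2) * f"
      "\<forall>k\<in>{1..n}. even (lookup ?v k + f)" by blast
    have "monom_degree ?u = (n - 2) * Suc f" using f(1) deg by simp
    moreover have "\<forall>k\<in>{1..n}. even (lookup ?u k + Suc f)" using f(2) parity by blast
    ultimately show ?L by (intro exI[of _ "Suc f"]) simp
  qed
  then show ?thesis by (simp only: affine_weight_def)
qed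

text \<open>
  For \<open>n = 2\<close> the product of the variables other than \<open>x\<^sub>i\<close> is the other variable; dropping the
  linear term in this case gives the generators of \<open>I\<^sub>n\<close> the same leading forms for all \<open>n \<ge> 2\<close>.
\<close>

definition generator :: "nat \<Rightarrow> nat \<Rightarrow> 'a::comm_ring_1 mpoly" where
  "generator n i = mon (sqfree ({1..n} - {i})) - (if n = 2 then 0 else mon (Poly_Mapping.single i 1))"

lemma I_generators_eq: "I_generators n = generator n ` {1..n}" if "n \<ge> 2"
proof (cases "n = 2")
  case True
  have "{1..2::nat} - {1} = {2}" "{1..2::nat} - {2} = {1}" "{1..2::nat} = {1, 2}" by auto
  then show ?thesis using True
    by (auto simp: I_generators_def generator_def sqfree_def Var_def)
next
  case False
  then show ?thesis by (simp add: I_generators_def generator_def prod_Var) (simp add: Var_def)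
qed

lemma exponents_sqfree: "S \<subseteq> {1..n} \<Longrightarrow> sqfree S \<in> exponents n"
  using finite_subset[of S "{1..n}"] by (simp add: keys_sqfree exponents_def)

lemma diff_in_carrier: "p \<in> carrier (mpoly_ring n) \<Longrightarrow> q \<in> carrier (mpoly_ring n) \<Longrightarrow>
   p - q \<in> carrier (mpoly_ring n)"
  using add_in_carrier[of p n "- q"] by (simp add: carrier_mpoly_ring)

lemma generator_in_carrier: "i \<in> {1..n} \<Longrightarrow> generator n i \<in> carrier (mpoly_ring n)"
  unfolding generator_def
  by (intro diff_in_carrier single_in_carrier exponents_sqfree)
     (auto simp: carrier_mpoly_ring exponents_def)

lemma generator_annihilated:
  assumes n: "n \<ge> 2" and i: "i \<in> {1..n}"
  shows "(generator n i :: 'a::comm_ring_1 mpoly) \<in> annihilator n (affine_weight n)"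
proof -
  have "linform (\<lambda>a. affine_weight n (a + m)) (generator n i :: 'a mpoly) = 0" for m
  proof (cases "n = 2")
    case True
    then have "monom_degree (sqfree ({1..n} - {i}) + m) \<noteq> 0"
      using i by (simp add: monom_degree_add monom_degree_sqfree)
    then show ?thesis using True by (simp add: generator_def affine_weight_def)
  next
    case False
    then show ?thesis using affine_weight_generator[OF _ i, of m] n
      by (simp add: generator_def linform_diff)
  qed
  then show ?thesis using generator_in_carrier[OF i] by (simp add: annihilator_def)
qed

lemma I_ideal_eq: "n \<ge> 2 \<Longrightarrow> I_ideal n = Idl\<^bsub>mpoly_ring n\<^esub> (generator n ` {1..n})"
  by (simp add: I_ideal_def I_generators_eq)

lemma ring_mpoly_ring: "ring (mpoly_ring n :: 'a::comm_ring_1 mpoly ring)"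
  by (rule cring.axioms(1)[OF cring_mpoly_ring])

lemma ideal_I_ideal: "n \<ge> 2 \<Longrightarrow> ideal (I_ideal n :: 'a::comm_ring_1 mpoly set) (mpoly_ring n)"
  unfolding I_ideal_eq
  by (rule ring.genideal_ideal[OF ring_mpoly_ring]) (auto intro: generator_in_carrier)

lemma generator_in_I_ideal: "n \<ge> 2 \<Longrightarrow> i \<in> {1..n} \<Longrightarrow> generator n i \<in> I_ideal n"
  unfolding I_ideal_eq
  using ring.genideal_self[OF ring_mpoly_ring, of "generator n ` {1..n}" n] generator_in_carrier
  by blast

lemma I_ideal_annihilated: "n \<ge> 2 \<Longrightarrow> I_ideal n \<subseteq> annihilator n (affine_weight n)"
  unfolding I_ideal_eq
  by (rule ring.genideal_minimal[OF ring_mpoly_ring ideal_annihilator])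
    (auto intro: generator_annihilated)

lemma lookup_hom_component:
  "lookup (hom_component d p) m = (if monom_degree m = d then lookup p m else 0)"
  by (simp add: hom_component_def lookup_sum lookup_single when_def in_keys_iff)

lemma keys_hom_component: "keys (hom_component d p) = {m \<in> keys p. monom_degree m = d}"
  by (auto simp: in_keys_iff lookup_hom_component split: if_splits)

lemma hom_component_in_carrier:
  "p \<in> carrier (mpoly_ring n) \<Longrightarrow> hom_component d p \<in> carrier (mpoly_ring n)"
  by (auto simp: carrier_mpoly_ring keys_hom_component)

lemma linform_hom_component:
  "linform w (hom_component d p) = (\<Sum>a\<in>keys p. if monom_degree a = d then lookup p a * w a else 0)"
  by (simp add: linform_def keys_hom_component lookup_hom_component sum.inter_filter)

lemma leading_form_eq:
  assumes "p \<noteq> 0" "\<And>m. m \<in> keys p \<Longrightarrow> monom_degree m \<le> d" "m \<in> keys p" "monom_degree m = d"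
  shows "leading_form p = hom_component d p"
proof -
  have "total_degree p = d" unfolding total_degree_def
    by (rule Max_eqI) (use assms in auto)
  then show ?thesis by (simp add: leading_form_def)
qed

text \<open>
  Let \<open>d\<close> be the degree of \<open>p\<close>. Pairing the leading form with \<open>m\<close> gives zero for reasons of degree
  unless \<open>m\<close> has degree \<open>2 (n - 2) - d\<close>. In that case all terms of \<open>p m\<close> have degree at most \<open>2 (n - 2)\<close>, where
  the two weights agree, and only the terms of the leading form contribute.
\<close>

lemma leading_form_annihilated:
  assumes n: "n \<ge> 2" and p: "p \<in> annihilator n (affine_weight n)"
  shows "leading_form p \<in> annihilator n (top_weight n)"
proof -
  let ?d = "total_degree p"
  have pc: "p \<in> carrier (mpoly_ring n)" using p by (simp add: annihilator_def)
  have "linform (\<lambda>a. top_weight n (a + m)) (leading_form p) = 0" if m: "m \<in> exponents n" for m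
  proof (cases "?d + monom_degree m = 2 * (n - 2)")
    case False
    then show ?thesis
      by (auto simp: leading_form_def linform_hom_component top_weight_def monom_degree_add
          intro!: sum.neutral)
  next
    case True
    have "(if monom_degree a = ?d then lookup p a * top_weight n (a + m) else 0) =
      lookup p a * affine_weight n (a + m)" if a: "a \<in> keys p" for a
    proof -
      have le: "monom_degree a \<le> ?d" using a by (simp add: total_degree_def)
      have "a + m \<in> exponents n" using a m pc by (auto simp: carrier_mpoly_ring)
      then have "affine_weight n (a + m) = (top_weight n (a + m) :: 'a)"
        using le True n by (intro affine_weight_eq_top_weight) (auto simp: monom_degree_add)
      moreover have "top_weight n (a + m) = (0 :: 'a)" if "monom_degree a \<noteq> ?d"
        using that True by (simp add: top_weight_def monom_degree_add)
      ultimately show ?thesis by auto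
    qed
    then have "linform (\<lambda>a. top_weight n (a + m)) (leading_form p) =
       linform (\<lambda>a. affine_weight n (a + m)) p"
      unfolding leading_form_def linform_hom_component by (simp add: linform_def)
    then show ?thesis using p m by (simp add: annihilator_def)
  qed
  then show ?thesis using hom_component_in_carrier[OF pc]
    by (simp add: annihilator_def leading_form_def)
qed

lemma leading_forms_annihilated:
  "n \<ge> 2 \<Longrightarrow> leading_form ` (I_ideal n - {0}) \<subseteq> annihilator n (top_weight n)"
  using I_ideal_annihilated leading_form_annihilated by blast

lemma annihilator_subset_carrier: "annihilator n w \<subseteq> carrier (mpoly_ring n)"
  by (auto simp: annihilator_def)

lemma ideal_K_ideal: "n \<ge> 2 \<Longrightarrow> ideal (K_ideal n :: 'a::comm_ring_1 mpoly set) (mpoly_ring n)"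
  unfolding K_ideal_def initial_ideal_def
  using leading_forms_annihilated annihilator_subset_carrier
  by (intro ring.genideal_ideal[OF ring_mpoly_ring]) blast

lemma K_ideal_subset_annihilator: "n \<ge> 2 \<Longrightarrow> K_ideal n \<subseteq> annihilator n (top_weight n)"
  unfolding K_ideal_def initial_ideal_def
  by (intro ring.genideal_minimal[OF ring_mpoly_ring ideal_annihilator] leading_forms_annihilated)

lemma leading_form_in_K_ideal:
  assumes "n \<ge> 2" "p \<in> I_ideal n" "p \<noteq> 0"
  shows "leading_form p \<in> K_ideal n"
proof -
  have "leading_form ` (I_ideal n - {0}) \<subseteq> K_ideal n"
    unfolding K_ideal_def initial_ideal_def
    using leading_forms_annihilated[OF assms(1)] annihilator_subset_carrier
    by (intro ring.genideal_self[OF ring_mpoly_ring]) blast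
  then show ?thesis using assms by blast
qed

section \<open>The initial ideal as the annihilator of a linear form\<close>

lemma leading_form_homogeneous:
  assumes "p \<noteq> 0" "\<And>m. m \<in> keys p \<Longrightarrow> monom_degree m = d"
  shows "leading_form p = p"
proof -
  obtain m where "m \<in> keys p" using assms(1) by (metis all_not_in_conv keys_eq_empty)
  then have "leading_form p = hom_component d p"
    using assms by (intro leading_form_eq[of p d m]) auto
  also have "\<dots> = p"
    using assms(2) by (intro poly_mapping_eqI) (auto simp: lookup_hom_component in_keys_iff)
  finally show ?thesis .
qed

lemma single_add_single_sqfree:
  assumes "finite S" "i \<notin> S"
  shows "Poly_Mapping.single i 1 + sqfree S = sqfree (insert i S)"
  using assms by (simp add: sqfree_def)

text \<open>
  For \<open>n \<ge> 3\<close>, multiplying the \<open>k\<close>-th generator by \<open>x\<^sub>k\<close> gives the product of all variables minus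
  \<open>x\<^sub>k\<^sup>2\<close>, so the difference of squares is an element of \<open>I\<^sub>n\<close> and, being homogeneous, its own leading form.
\<close>

lemma square_difference_in_K_ideal:
  assumes n: "n \<ge> 2" and i: "i \<in> {1..n}" and j: "j \<in> {1..n}"
  shows "mon (Poly_Mapping.single i 2) - mon (Poly_Mapping.single j 2) \<in>
    (K_ideal n :: 'a::comm_ring_1 mpoly set)"
proof (cases "i = j")
  case True
  then show ?thesis using ideal_zero[OF ideal_K_ideal[OF n]] by simp
next
  case False
  let ?p = "mon (Poly_Mapping.single i 2) - mon (Poly_Mapping.single j 2) :: 'a mpoly"
  let ?x = "\<lambda>k. mon (Poly_Mapping.single k 1) :: 'a mpoly"
  have I: "ideal (I_ideal n :: 'a mpoly set) (mpoly_ring n)" by (rule ideal_I_ideal[OF n])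
  have x: "?x k \<in> carrier (mpoly_ring n)" if "k \<in> {1..n}" for k
    using that by (intro single_in_carrier) (simp add: single_in_exponents)
  have sq: "?x k * ?x k = mon (Poly_Mapping.single k 2)" for k
    by (simp add: mult_single single_add[symmetric] numeral_2_eq_2)
  have "?p \<in> I_ideal n"
  proof (cases "n = 2")
    case True
    \<comment> \<open>For \<open>n = 2\<close> the index other than \<open>k\<close> is \<open>3 - k\<close>.\<close>
    have g: "?x k \<in> I_ideal n" if "k \<in> {1..n}" for k
    proof -
      have "{1..n} - {3 - k} = {k}" "3 - k \<in> {1..n}" using that True by (auto, presburger)
      then have "generator n (3 - k) = ?x k" using True by (simp add: generator_def sqfree_def)
      then show ?thesis using generator_in_I_ideal[OF n \<open>3 - k \<in> {1..n}\<close>] by metis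
    qed
    have "?x i * ?x i - ?x j * ?x j \<in> I_ideal n"
      by (intro ideal_diff[OF I] ideal_mult[OF I] g x i j)
    then show ?thesis by (simp only: sq)
  next
    case False
    have g: "?x k * generator n k = mon (sqfree {1..n}) - mon (Poly_Mapping.single k 2)"
      if "k \<in> {1..n}" for k
    proof -
      have "insert k ({1..n} - {k}) = {1..n}" using that by auto
      then have "?x k * mon (sqfree ({1..n} - {k})) = mon (sqfree {1..n})"
        using single_add_single_sqfree[of "{1..n} - {k}" k] by (simp add: mult_single)
      then show ?thesis using False sq[of k] by (simp add: generator_def right_diff_distrib)
    qed
    have "?x j * generator n j - ?x i * generator n i \<in> I_ideal n"
      by (intro ideal_diff[OF I] ideal_mult[OF I] generator_in_I_ideal[OF n] x i j)
    then show ?thesis using g[OF i] g[OF j] by simp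
  qed
  moreover have nz: "?p \<noteq> 0"
  proof
    assume "?p = 0"
    then have "lookup ?p (Poly_Mapping.single i 2) = 0" by simp
    moreover have "lookup (Poly_Mapping.single j (2::nat)) i \<noteq> lookup (Poly_Mapping.single i 2) i"
      using False by (simp add: lookup_single when_def)
    then have "Poly_Mapping.single j (2::nat) \<noteq> Poly_Mapping.single i 2" by (rule contrapos_nn) (rule arg_cong)
    ultimately show False by (simp add: lookup_minus lookup_single when_def)
  qed
  moreover have "monom_degree m = 2" if "m \<in> keys ?p" for m
    using that keys_diff[of "mon (Poly_Mapping.single i 2) :: 'a mpoly" "mon (Poly_Mapping.single j 2)"]
    by (auto split: if_splits)
  ultimately show ?thesis
    using leading_form_in_K_ideal[OF n, of ?p] leading_form_homogeneous[OF nz, of 2] by simp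
qed

lemma submaximal_product_in_K_ideal:
  assumes n: "n \<ge> 2" and i: "i \<in> {1..n}"
  shows "mon (sqfree ({1..n} - {i})) \<in> (K_ideal n :: 'a::comm_ring_1 mpoly set)"
proof -
  let ?s = "sqfree ({1..n} - {i})"
  let ?g = "generator n i :: 'a mpoly"
  have deg: "monom_degree ?s = n - 1" using i by (simp add: monom_degree_sqfree)
  have ne: "Poly_Mapping.single i 1 \<noteq> ?s" if "n \<noteq> 2"
  proof
    assume "Poly_Mapping.single i 1 = ?s"
    from arg_cong[OF this, of monom_degree] show False using deg that n by simp
  qed
  have look: "lookup ?g ?s = 1" using ne
    by (auto simp: generator_def lookup_minus lookup_single when_def)
  then have nz: "?g \<noteq> 0" and key: "?s \<in> keys ?g" by (auto simp: in_keys_iff)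
  have keys: "m = ?s \<or> n \<noteq> 2 \<and> m = Poly_Mapping.single i 1" if "m \<in> keys ?g" for m
    using that by (auto simp: generator_def in_keys_iff lookup_minus lookup_single when_def split: if_splits)
  have "leading_form ?g = hom_component (n - 1) ?g"
    using nz key deg keys n by (intro leading_form_eq[of _ _ ?s]) (force simp: )+
  also have "\<dots> = mon ?s"
  proof (rule poly_mapping_eqI)
    fix m
    have "m = ?s" if "m \<in> keys ?g" "monom_degree m = n - 1"
      using keys[OF that(1)] that(2) n by auto
    then show "lookup (hom_component (n - 1) ?g) m = lookup (mon ?s) m"
      using deg look by (cases "m = ?s") (auto simp: lookup_hom_component lookup_single in_keys_iff when_def)
  qed
  finally show ?thesis
    using leading_form_in_K_ideal[OF n generator_in_I_ideal[OF n i] nz] by simp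
qed

definition odd_part :: "nat \<Rightarrow> (nat \<Rightarrow>\<^sub>0 nat) \<Rightarrow> nat set" where
  "odd_part n m = {i \<in> {1..n}. odd (lookup m i)}"

text \<open>
  A monomial with prescribed set \<open>S\<close> of odd exponents and degree \<open>d\<close>, all surplus being
  put on \<open>x\<^sub>1\<close>. It has these properties if \<open>S \<subseteq> {1..n}\<close> and \<open>d - card S\<close> is even and nonnegative.
\<close>

definition class_rep :: "nat set \<Rightarrow> nat \<Rightarrow> (nat \<Rightarrow>\<^sub>0 nat)" where
  "class_rep S d = sqfree S + Poly_Mapping.single 1 (d - card S)"

lemma finite_odd_part [simp]: "finite (odd_part n m)"
  by (simp add: odd_part_def)

lemma odd_part_subset: "odd_part n m \<subseteq> {1..n}"
  by (auto simp: odd_part_def)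

lemma parity_degree:
  assumes "m \<in> exponents n"
  shows "card (odd_part n m) \<le> monom_degree m" "even (monom_degree m - card (odd_part n m))"
proof -
  have "monom_degree m = (\<Sum>i\<in>{1..n}. of_bool (odd (lookup m i)) + 2 * (lookup m i div 2))"
    unfolding monom_degree_exponents[OF assms] by (intro sum.cong) (auto simp: of_bool_def)
  also have "\<dots> = card (odd_part n m) + 2 * (\<Sum>i\<in>{1..n}. lookup m i div 2)"
    by (simp add: sum.distrib odd_part_def sum_distrib_left Int_def conj_commute)
  finally have "monom_degree m = card (odd_part n m) + 2 * (\<Sum>i\<in>{1..n}. lookup m i div 2)" .
  then show "card (odd_part n m) \<le> monom_degree m" "even (monom_degree m - card (odd_part n m))"
    by simp_all
qed

text \<open>
  A square of a variable other than \<open>x\<^sub>1\<close> can be traded for \<open>x\<^sub>1\<^sup>2\<close>, which lowers the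
  degree in the other variables; when none is left, the monomial is the representative.
\<close>

lemma congruent_class_rep:
  assumes n: "n \<ge> 2" and m: "m \<in> exponents n"
  shows "mon m - mon (class_rep (odd_part n m) (monom_degree m)) \<in>
    (K_ideal n :: 'a::comm_ring_1 mpoly set)"
  using m
proof (induction "monom_degree m - lookup m 1" arbitrary: m rule: less_induct)
  case less
  have K: "ideal (K_ideal n :: 'a mpoly set) (mpoly_ring n)" by (rule ideal_K_ideal[OF n])
  show ?case
  proof (cases "\<exists>i\<in>{2..n}. lookup m i \<ge> 2")
    case True
    then obtain i where i: "i \<in> {2..n}" "lookup m i \<ge> 2" by blast
    \<comment> \<open>Trade \<open>x\<^sub>i\<^sup>2\<close> for \<open>x\<^sub>1\<^sup>2\<close>.\<close>
    define r where "r = m - Poly_Mapping.single i 2"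
    define m' where "m' = Poly_Mapping.single 1 2 + r"
    have m_eq: "m = Poly_Mapping.single i 2 + r"
      by (rule poly_mapping_eqI) (use i in \<open>auto simp: r_def lookup_add lookup_minus lookup_single when_def\<close>)
    have r: "r \<in> exponents n" using less.prems by (simp add: m_eq)
    then have m': "m' \<in> exponents n" using n by (simp add: m'_def single_in_exponents)
    have deg: "monom_degree m' = monom_degree m" by (simp add: m_eq m'_def monom_degree_add)
    have odd: "odd_part n m' = odd_part n m"
      by (auto simp: odd_part_def m_eq m'_def lookup_add lookup_single when_def)
    have look: "lookup m' 1 = lookup m 1 + 2"
      using i by (simp add: m_eq m'_def lookup_add lookup_single when_def)
    have "(\<Sum>k\<in>{1, i}. lookup m k) \<le> monom_degree m"
      using i n unfolding monom_degree_exponents[OF less.prems] by (intro sum_mono2) auto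
    then have "monom_degree m - (lookup m 1 + 2) < monom_degree m - lookup m 1" using i by simp
    then have IH: "mon m' - mon (class_rep (odd_part n m) (monom_degree m)) \<in> (K_ideal n :: 'a mpoly set)"
      by (rule less.hyps[OF _ m', unfolded deg odd look])
    have "mon r * (mon (Poly_Mapping.single i 2) - mon (Poly_Mapping.single 1 2)) \<in> (K_ideal n :: 'a mpoly set)"
      using i n by (intro ideal_mult[OF K] square_difference_in_K_ideal single_in_carrier r) auto
    then have "mon m - mon m' \<in> (K_ideal n :: 'a mpoly set)"
      by (simp add: m_eq m'_def right_diff_distrib mult_single add.commute)
    from ideal_add[OF K this IH] show ?thesis by simp
  next
    case False
    have look: "lookup m i = of_bool (i \<in> odd_part n m)" if "i \<noteq> 1" for i
    proof (cases "i \<in> {2..n}")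
      case True
      then have "lookup m i < 2" using False by force
      then have "lookup m i = 0 \<or> lookup m i = 1" by linarith
      then show ?thesis using True by (auto simp: odd_part_def)
    next
      case False
      with that have "i \<notin> {1..n}" by auto
      then show ?thesis using less.prems by (auto simp: odd_part_def exponents_def in_keys_iff)
    qed
    have "monom_degree m = lookup m 1 + (\<Sum>i\<in>{1..n} - {1}. lookup m i)"
      unfolding monom_degree_exponents[OF less.prems] using n by (intro sum.remove) auto
    also have "(\<Sum>i\<in>{1..n} - {1}. lookup m i) = (\<Sum>i\<in>{1..n} - {1}. of_bool (i \<in> odd_part n m))"
      by (intro sum.cong) (auto simp: look)
    also have "\<dots> = card (odd_part n m - {1})"
      using odd_part_subset[of n m] by (simp add: Int_def) (rule arg_cong[of _ _ card], auto)
    finally have deg: "monom_degree m = lookup m 1 + card (odd_part n m - {1})" .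
    have "lookup m 1 = of_bool (1 \<in> odd_part n m) + (monom_degree m - card (odd_part n m))"
    proof (cases "1 \<in> odd_part n m")
      case True
      then have "lookup m 1 \<ge> 1" by (cases "lookup m 1") (auto simp: odd_part_def)
      moreover have "card (odd_part n m) \<ge> 1" using True by (metis One_nat_def Suc_leI card_gt_0_iff empty_iff finite_odd_part)
      ultimately show ?thesis using deg True by (simp add: card_Diff_singleton)
    next
      case False
      then show ?thesis using deg by simp
    qed
    then have "class_rep (odd_part n m) (monom_degree m) = m"
      using look
      by (intro poly_mapping_eqI) (auto simp: class_rep_def lookup_add lookup_sqfree lookup_single when_def)
    then show ?thesis using ideal_zero[OF K] by simp
  qed
qed

text \<open>
  Choose \<open>i\<close> so that the set \<open>T\<close> of indices outside \<open>S\<close> and different from \<open>i\<close> has at most \<open>k\<close>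
  elements. Then the class of \<open>m\<close> contains a monomial in which every variable with index in \<open>T\<close>
  is squared, and it is divisible by the product of all variables but \<open>x\<^sub>i\<close>.
\<close>

lemma large_class_in_K_ideal:
  assumes n: "n \<ge> 2" and m: "m \<in> exponents n"
    and S: "S = odd_part n m" and k: "monom_degree m = card S + 2 * k" "card S + k \<ge> n - 1"
  shows "mon m \<in> (K_ideal n :: 'a::comm_ring_1 mpoly set)"
proof -
  have K: "ideal (K_ideal n :: 'a mpoly set) (mpoly_ring n)" by (rule ideal_K_ideal[OF n])
  have S_sub: "S \<subseteq> {1..n}" and finS: "finite S" using odd_part_subset[of n m] S by auto
  obtain i where i: "i \<in> {1..n}" "card ({1..n} - {i} - S) \<le> k"
  proof (cases "S = {1..n}")
    case True
    then have "{1..n} - {1} - S = {}" by auto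
    then show ?thesis using that[of 1] n by (metis atLeastAtMost_iff card.empty le0 le_refl one_le_numeral order_trans)
  next
    case False
    then obtain i where i: "i \<in> {1..n}" "i \<notin> S" using S_sub by blast
    have "{1..n} - {i} - S = {1..n} - insert i S" by auto
    moreover have "card ({1..n} - insert i S) = n - Suc (card S)"
      using i S_sub finS by (subst card_Diff_subset) auto
    ultimately show ?thesis using that[of i] i k(2) by simp
  qed
  define T where "T = {1..n} - {i} - S"
  \<comment> \<open>The divisible member of the class: squares on \<open>T\<close>, the rest of the degree on \<open>x\<^sub>1\<close>.\<close>
  define b where "b = sqfree S + (sqfree T + sqfree T) + Poly_Mapping.single 1 (2 * (k - card T))"
  have finT: "finite T" and TS: "T \<subseteq> {1..n}" "T \<inter> S = {}" by (auto simp: T_def)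
  have b: "b \<in> exponents n" unfolding b_def
    using n S_sub TS by (simp add: exponents_sqfree single_in_exponents)
  have "lookup b j = of_bool (j \<in> S) + 2 * of_bool (j \<in> T) + (if j = 1 then 2 * (k - card T) else 0)" for j
    using finS finT by (simp add: b_def lookup_add lookup_sqfree lookup_single when_def)
  then have odd_b: "odd_part n b = S" using S_sub by (auto simp: odd_part_def)
  have deg_b: "monom_degree b = monom_degree m"
    using i(2) finS finT by (simp add: b_def monom_degree_add monom_degree_sqfree k(1) T_def)
  have "lookup (sqfree ({1..n} - {i})) j \<le> lookup b j" for j
    using finS finT by (auto simp: b_def lookup_add lookup_sqfree T_def)
  then have b_eq: "b = (b - sqfree ({1..n} - {i})) + sqfree ({1..n} - {i})"
    by (intro poly_mapping_eqI) (simp add: lookup_add lookup_minus)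
  have "b - sqfree ({1..n} - {i}) \<in> exponents n"
    using b by (subst (asm) b_eq) simp
  then have "mon (b - sqfree ({1..n} - {i})) * mon (sqfree ({1..n} - {i})) \<in> (K_ideal n :: 'a mpoly set)"
    by (intro ideal_mult[OF K] submaximal_product_in_K_ideal n i single_in_carrier)
  then have bK: "mon b \<in> (K_ideal n :: 'a mpoly set)"
    by (simp only: mult_single mult_1_right b_eq[symmetric])
  have "mon m - mon (class_rep S (monom_degree m)) \<in> (K_ideal n :: 'a mpoly set)"
    using congruent_class_rep[OF n m] S by simp
  moreover have "mon b - mon (class_rep S (monom_degree m)) \<in> (K_ideal n :: 'a mpoly set)"
    using congruent_class_rep[OF n b] odd_b deg_b by simp
  ultimately have "mon m - mon b \<in> (K_ideal n :: 'a mpoly set)"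
    using ideal_diff[OF K] by fastforce
  from ideal_add[OF K this bK] show ?thesis by simp
qed

text \<open>
  The monomial \<open>q\<close> with the same odd exponents \<open>S\<close> and the complementary degree
  \<open>2 (n - 2) - d\<close> exists because \<open>card S + k \<le> n - 2\<close>. Its product with \<open>a\<close> has even exponents and degree
  \<open>2 (n - 2)\<close> exactly when \<open>a\<close> belongs to the class given by \<open>S\<close> and \<open>d\<close>.
\<close>

lemma class_coefficient_sum_eq_0:
  assumes p: "(p :: 'a::comm_ring_1 mpoly) \<in> annihilator n (top_weight n)" and n: "n \<ge> 2"
    and S: "S \<subseteq> {1..n}" and k: "card S + k \<le> n - 2" and d: "d = card S + 2 * k"
  shows "(\<Sum>a\<in>{a \<in> keys p. odd_part n a = S \<and> monom_degree a = d}. lookup p a) = 0"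
proof -
  have finS: "finite S" using S finite_subset by blast
  define q where "q = sqfree S + Poly_Mapping.single 1 (2 * (n - 2 - card S - k))"
  have q: "q \<in> exponents n"
    using n S by (simp add: q_def exponents_sqfree single_in_exponents)
  have deg_q: "monom_degree q + d = 2 * (n - 2)"
    using k d finS by (simp add: q_def monom_degree_add monom_degree_sqfree)
  have odd_q: "odd (lookup q i) \<longleftrightarrow> i \<in> S" for i
    using finS by (simp add: q_def lookup_add lookup_sqfree lookup_single when_def)
  have "top_weight n (a + q) = (of_bool (odd_part n a = S \<and> monom_degree a = d) :: 'a)" for a
  proof -
    have "(\<forall>i\<in>{1..n}. even (lookup (a + q) i)) \<longleftrightarrow> (\<forall>i\<in>{1..n}. odd (lookup a i) \<longleftrightarrow> i \<in> S)"
      by (simp add: lookup_add flip: odd_q)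
    also have "\<dots> \<longleftrightarrow> odd_part n a = S"
      using S by (auto simp: odd_part_def)
    finally have "(\<forall>i\<in>{1..n}. even (lookup (a + q) i)) \<longleftrightarrow> odd_part n a = S" .
    moreover have "monom_degree (a + q) = 2 * (n - 2) \<longleftrightarrow> monom_degree a = d"
      using deg_q by (auto simp: monom_degree_add)
    ultimately show ?thesis by (simp only: top_weight_def conj_commute)
  qed
  then have "linform (\<lambda>a. top_weight n (a + q)) p =
     (\<Sum>a\<in>keys p. if odd_part n a = S \<and> monom_degree a = d then lookup p a else 0)"
    unfolding linform_def by (intro sum.cong) auto
  also have "\<dots> = (\<Sum>a\<in>{a \<in> keys p. odd_part n a = S \<and> monom_degree a = d}. lookup p a)"
    by (simp add: sum.inter_filter)
  finally show ?thesis using p q by (simp add: annihilator_def)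
qed

text \<open>
  Modulo \<open>K\<^sub>n\<close> the polynomial \<open>p\<close> is the sum over all classes of the representative times
  the sum of the coefficients in the class, and in each of these products one factor vanishes.
\<close>

lemma annihilator_subset_K_ideal:
  assumes n: "n \<ge> 2"
  shows "annihilator n (top_weight n) \<subseteq> (K_ideal n :: 'a::comm_ring_1 mpoly set)"
proof
  fix p :: "'a mpoly" assume p: "p \<in> annihilator n (top_weight n)"
  have K: "ideal (K_ideal n :: 'a mpoly set) (mpoly_ring n)" by (rule ideal_K_ideal[OF n])
  have exp: "a \<in> exponents n" if "a \<in> keys p" for a
    using that p by (auto simp: annihilator_def carrier_mpoly_ring)
  define cls where "cls a = (odd_part n a, monom_degree a)" for a
  define rep where "rep = (\<lambda>(S, d). class_rep S d)"
  have "Poly_Mapping.single a (lookup p a) - Poly_Mapping.single (rep (cls a)) (lookup p a) \<in> K_ideal n"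
    if "a \<in> keys p" for a
  proof -
    have "const (lookup p a) * (mon a - mon (rep (cls a))) \<in> K_ideal n"
      using congruent_class_rep[OF n exp[OF that], where ?'a = 'a]
      by (intro ideal_mult[OF K] const_in_carrier) (simp add: rep_def cls_def)
    then show ?thesis by (simp add: right_diff_distrib mult_single)
  qed
  then have "(\<Sum>a\<in>keys p. Poly_Mapping.single a (lookup p a) -
      Poly_Mapping.single (rep (cls a)) (lookup p a)) \<in> K_ideal n"
    by (rule ideal_sum[OF K])
  then have 1: "p - (\<Sum>a\<in>keys p. Poly_Mapping.single (rep (cls a)) (lookup p a)) \<in> K_ideal n"
    by (simp add: sum_subtractf sum_monomials)
  have "(\<Sum>a\<in>keys p. Poly_Mapping.single (rep (cls a)) (lookup p a)) =
      (\<Sum>c\<in>cls ` keys p. \<Sum>a\<in>{a \<in> keys p. cls a = c}. Poly_Mapping.single (rep (cls a)) (lookup p a))"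
    by (rule sum.image_gen) simp
  also have "\<dots> = (\<Sum>c\<in>cls ` keys p. Poly_Mapping.single (rep c) (\<Sum>a\<in>{a \<in> keys p. cls a = c}. lookup p a))"
    (is "_ = ?rhs")
  proof (rule sum.cong[OF refl])
    fix c
    show "(\<Sum>a\<in>{a \<in> keys p. cls a = c}. Poly_Mapping.single (rep (cls a)) (lookup p a)) =
      Poly_Mapping.single (rep c) (\<Sum>a\<in>{a \<in> keys p. cls a = c}. lookup p a)"
      by (intro poly_mapping_eqI) (simp add: lookup_sum lookup_single when_def)
  qed
  also have "?rhs \<in> K_ideal n"
  proof (rule ideal_sum[OF K])
    fix c assume "c \<in> cls ` keys p"
    then obtain a where a: "a \<in> keys p" "c = cls a" by blast
    let ?S = "odd_part n a"
    from parity_degree[OF exp[OF a(1)]] obtain k where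
      k: "monom_degree a = card ?S + 2 * k" by (metis dvdE le_add_diff_inverse)
    show "Poly_Mapping.single (rep c) (\<Sum>a\<in>{a \<in> keys p. cls a = c}. lookup p a) \<in> K_ideal n"
    proof (cases "card ?S + k \<le> n - 2")
      case True
      have "(\<Sum>a\<in>{a \<in> keys p. cls a = c}. lookup p a) = 0"
        using class_coefficient_sum_eq_0[OF p n odd_part_subset True k]
        by (simp add: a(2) cls_def)
      then show ?thesis using ideal_zero[OF K] by simp
    next
      case False
      then have "card ?S + k \<ge> n - 1" using n by linarith
      then have "mon a \<in> (K_ideal n :: 'a mpoly set)"
        using large_class_in_K_ideal[OF n exp[OF a(1)] refl k] by blast
      from ideal_diff[OF K this congruent_class_rep[OF n exp[OF a(1)]]]
      have "mon (rep c) \<in> (K_ideal n :: 'a mpoly set)" by (simp add: a(2) rep_def cls_def)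
      then show ?thesis by (rule ideal_scale[OF K])
    qed
  qed
  finally have 2: "(\<Sum>a\<in>keys p. Poly_Mapping.single (rep (cls a)) (lookup p a)) \<in> K_ideal n" .
  from ideal_add[OF K 1 2] show "p \<in> K_ideal n" by simp
qed

lemma K_ideal_eq_annihilator: "n \<ge> 2 \<Longrightarrow> K_ideal n = annihilator n (top_weight n)"
  using K_ideal_subset_annihilator annihilator_subset_K_ideal by blast

section \<open>Homogeneity, primes and socle modulo the annihilator\<close>

lemma homogeneous_annihilator_top_weight:
  "homogeneous_ideal n (annihilator n (top_weight n) :: 'a::comm_ring_1 mpoly set)"
  unfolding homogeneous_ideal_def
proof (intro conjI ballI allI)
  fix p :: "'a mpoly" and d assume p: "p \<in> annihilator n (top_weight n)"
  have "linform (\<lambda>a. top_weight n (a + m)) (hom_component d p) = 0" if m: "m \<in> exponents n" for m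
  proof (cases "d + monom_degree m = 2 * (n - 2)")
    case False
    then show ?thesis
      by (auto simp: linform_hom_component top_weight_def monom_degree_add intro!: sum.neutral)
  next
    case True
    have "(if monom_degree a = d then lookup p a * top_weight n (a + m) else 0) =
      lookup p a * top_weight n (a + m)" for a
      using True by (auto simp: top_weight_def monom_degree_add)
    then have "linform (\<lambda>a. top_weight n (a + m)) (hom_component d p) =
      linform (\<lambda>a. top_weight n (a + m)) p"
      unfolding linform_hom_component linform_def[of _ p] by (rule sum.cong[OF refl])
    then show ?thesis using p m by (simp add: annihilator_def)
  qed
  then show "hom_component d p \<in> annihilator n (top_weight n)"
    using p hom_component_in_carrier by (auto simp: annihilator_def)
qed (rule ideal_annihilator)

definition origin_ideal :: "nat \<Rightarrow> 'a::comm_ring_1 mpoly set" where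
  "origin_ideal n = {p \<in> carrier (mpoly_ring n). lookup p 0 = 0}"

lemma add_eq_0_exponent: "a + b = 0 \<longleftrightarrow> a = 0 \<and> b = (0 :: nat \<Rightarrow>\<^sub>0 nat)"
  by (metis add_is_0 monom_degree_add monom_degree_eq_0)

lemma linform_of_bool_0: "linform (\<lambda>a. of_bool (a = 0)) p = lookup p 0"
  by (simp add: linform_def in_keys_iff of_bool_def if_distrib cong: if_cong)

lemma lookup_mult_0: "lookup (p * q) 0 = lookup p 0 * lookup (q :: 'a::comm_ring_1 mpoly) 0"
proof -
  have shift: "linform (\<lambda>a. of_bool (a + m = 0)) p = of_bool (m = 0) * lookup p 0" for m
    by (cases "m = 0") (simp_all add: linform_of_bool_0 add_eq_0_exponent, simp add: linform_def)
  have "linform (\<lambda>a. of_bool (a = 0)) (p * q) = (\<Sum>m\<in>keys q. lookup q m * (of_bool (m = 0) * lookup p 0))"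
    unfolding linform_mult shift ..
  also have "\<dots> = linform (\<lambda>a. of_bool (a = 0)) q * lookup p 0"
    unfolding linform_def sum_distrib_right mult.assoc ..
  finally show ?thesis by (simp add: linform_of_bool_0 mult.commute)
qed

lemma ideal_origin_ideal: "ideal (origin_ideal n :: 'a::comm_ring_1 mpoly set) (mpoly_ring n)"
  by (rule ideal_mpoly_ringI)
    (auto simp: origin_ideal_def lookup_add lookup_mult_0 zero_in_carrier
      intro: add_in_carrier mult_in_carrier)

lemma maximalideal_origin_ideal:
  "maximalideal (origin_ideal n :: 'a::field mpoly set) (mpoly_ring n)"
proof (rule maximalidealI[OF ideal_origin_ideal])
  have "1 \<in> carrier (mpoly_ring n)" "1 \<notin> (origin_ideal n :: 'a mpoly set)"
    by (simp_all add: origin_ideal_def carrier_mpoly_ring)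
  then show "carrier (mpoly_ring n) \<noteq> (origin_ideal n :: 'a mpoly set)" by blast
next
  fix J :: "'a mpoly set"
  assume J: "ideal J (mpoly_ring n)" and sub: "origin_ideal n \<subseteq> J" "J \<subseteq> carrier (mpoly_ring n)"
  show "J = origin_ideal n \<or> J = carrier (mpoly_ring n)"
  proof (cases "J \<subseteq> origin_ideal n")
    case True
    then show ?thesis using sub by blast
  next
    case False
    then obtain p where p: "p \<in> J" "lookup p 0 \<noteq> 0" using sub by (auto simp: origin_ideal_def)
    have "p - const (lookup p 0) \<in> origin_ideal n"
      using p sub by (auto simp: origin_ideal_def lookup_minus intro: diff_in_carrier const_in_carrier)
    then have "p - const (lookup p 0) \<in> J" using sub by blast
    from ideal_diff[OF J p(1) this] have "p - (p - const (lookup p 0)) \<in> J" .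
    then have "const (inverse (lookup p 0)) * (p - (p - const (lookup p 0))) \<in> J"
      by (rule ideal_mult[OF J _ const_in_carrier])
    then have one: "1 \<in> J" using p by (simp add: mult_single)
    have "q \<in> J" if "q \<in> carrier (mpoly_ring n)" for q
      using ideal_mult[OF J one that] by simp
    then show ?thesis using sub by blast
  qed
qed

lemma high_degree_in_annihilator:
  assumes "m \<in> exponents n" "monom_degree m > 2 * (n - 2)"
  shows "mon m \<in> annihilator n (top_weight n)"
  using assms by (auto simp: annihilator_def single_in_carrier top_weight_def monom_degree_add)

text \<open>
  So \<open>x\<^sub>1\<^sup>D\<close>, with \<open>D = 2 (n - 2)\<close>, is dual to the monomial \<open>1\<close>: pairing with it extracts constant terms.
\<close>

lemma top_weight_socle:
  "top_weight n (Poly_Mapping.single 1 (2 * (n - 2)) + m) = of_bool (m = 0)"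
  by (auto simp: top_weight_def monom_degree_add monom_degree_eq_0 lookup_single when_def)

lemma annihilator_subset_origin_ideal:
  assumes "n \<ge> 2"
  shows "annihilator n (top_weight n) \<subseteq> (origin_ideal n :: 'a::comm_ring_1 mpoly set)"
proof
  fix p :: "'a mpoly" assume p: "p \<in> annihilator n (top_weight n)"
  let ?s = "Poly_Mapping.single 1 (2 * (n - 2)) :: nat \<Rightarrow>\<^sub>0 nat"
  have "linform (\<lambda>a. top_weight n (a + ?s)) p = lookup p 0"
    by (subst add.commute) (simp only: top_weight_socle linform_of_bool_0)
  moreover have "?s \<in> exponents n" using assms by (simp add: single_in_exponents)
  ultimately show "p \<in> origin_ideal n" using p by (auto simp: annihilator_def origin_ideal_def)
qed

lemma variable_in_prime_if_power:
  assumes "primeideal P (mpoly_ring n)" "mon (Poly_Mapping.single i (Suc k)) \<in> (P :: 'a::comm_ring_1 mpoly set)"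
    "i \<in> {1..n}"
  shows "mon (Poly_Mapping.single i 1) \<in> P"
  using assms(2)
proof (induction k)
  case (Suc k)
  have car: "mon (Poly_Mapping.single i k) \<in> carrier (mpoly_ring n)" for k
    using assms(3) by (intro single_in_carrier) (simp add: single_in_exponents)
  have "mon (Poly_Mapping.single i 1) * mon (Poly_Mapping.single i (Suc k)) \<in> P"
    using Suc.prems by (simp add: mult_single single_add[symmetric])
  then have "mon (Poly_Mapping.single i 1) \<in> P \<or> mon (Poly_Mapping.single i (Suc k)) \<in> P"
    using primeideal.I_prime[OF assms(1)] car by force
  then show ?case using Suc.IH by blast
qed simp

text \<open>
  The ideal \<open>P\<close> contains high powers of all variables, hence the variables themselves, hence
  the ideal of the origin, which is maximal.
\<close>

lemma prime_over_annihilator: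
  assumes P: "primeideal P (mpoly_ring n)" and sub: "annihilator n (top_weight n) \<subseteq> P"
  shows "P = (origin_ideal n :: 'a::field mpoly set)"
proof -
  have I: "ideal P (mpoly_ring n)" using P by (rule primeideal.axioms(1))
  have var: "mon (Poly_Mapping.single i 1) \<in> P" if i: "i \<in> {1..n}" for i
  proof -
    have "mon (Poly_Mapping.single i (Suc (2 * n))) \<in> P"
      using i sub by (intro subsetD[OF sub] high_degree_in_annihilator) (simp_all add: single_in_exponents)
    then show ?thesis by (rule variable_in_prime_if_power[OF P _ i])
  qed
  have "p \<in> P" if p: "p \<in> origin_ideal n" for p
  proof -
    have "Poly_Mapping.single m (lookup p m) \<in> P" if m: "m \<in> keys p" for m
    proof -
      have m0: "m \<noteq> 0" and me: "m \<in> exponents n"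
        using p m by (auto simp: origin_ideal_def carrier_mpoly_ring in_keys_iff)
      then obtain i where i: "i \<in> keys m" by (metis all_not_in_conv keys_eq_empty)
      define r where "r = m - Poly_Mapping.single i 1"
      have m_eq: "m = r + Poly_Mapping.single i 1"
        by (rule poly_mapping_eqI) (use i in \<open>auto simp: r_def lookup_add lookup_minus lookup_single when_def in_keys_iff\<close>)
      have "i \<in> {1..n}" "r \<in> exponents n" using i me by (auto simp: exponents_def m_eq keys_add_nat)
      then have "mon r * mon (Poly_Mapping.single i 1) \<in> P"
        by (intro ideal_mult[OF I] var single_in_carrier)
      then have "mon m \<in> P" by (simp add: mult_single m_eq)
      then show ?thesis by (rule ideal_scale[OF I])
    qed
    then have "(\<Sum>m\<in>keys p. Poly_Mapping.single m (lookup p m)) \<in> P" by (rule ideal_sum[OF I])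
    then show ?thesis by (simp add: sum_monomials)
  qed
  then have "origin_ideal n \<subseteq> P" by blast
  moreover have "P \<subseteq> carrier (mpoly_ring n)" by (rule ideal_subset_carrier[OF I])
  moreover have "P \<noteq> carrier (mpoly_ring n)" using primeideal.I_notcarr[OF P] by blast
  ultimately show ?thesis using maximalideal.I_maximal[OF maximalideal_origin_ideal I] by blast
qed

text \<open>
  Both \<open>p\<close> and the multiple of \<open>x\<^sub>1\<^sup>D\<close> pair to zero with every monomial except \<open>1\<close>; the scalar is
  chosen so that they also agree there.
\<close>

lemma socle_multiple_of_top_power:
  assumes n: "n \<ge> 2" and p: "p \<in> carrier (mpoly_ring n)"
    and kill: "\<And>q. q \<in> origin_ideal n \<Longrightarrow> q * p \<in> annihilator n (top_weight n)"
  shows "p - const (linform (top_weight n) p) * mon (Poly_Mapping.single 1 (2 * (n - 2))) \<in>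
    (annihilator n (top_weight n) :: 'a::comm_ring_1 mpoly set)"
proof -
  let ?s = "Poly_Mapping.single 1 (2 * (n - 2)) :: nat \<Rightarrow>\<^sub>0 nat"
  let ?c = "linform (top_weight n) p"
  have s: "?s \<in> exponents n" using n by (simp add: single_in_exponents)
  have "linform (\<lambda>a. top_weight n (a + m)) (p - const ?c * mon ?s) = 0" if m: "m \<in> exponents n" for m
  proof -
    have "linform (\<lambda>a. top_weight n (a + m)) p = ?c * of_bool (m = 0)"
    proof (cases "m = 0")
      case False
      then have "mon m \<in> (origin_ideal n :: 'a mpoly set)"
        using m by (simp add: origin_ideal_def single_in_carrier lookup_single)
      from linform_annihilator_mult[OF kill[OF this], of 1] show ?thesis
        using False by (simp add: linform_shift mult.commute carrier_mpoly_ring)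
    qed simp
    then show ?thesis
      by (simp only: linform_diff mult_single linform_single add_0_left mult_1_right top_weight_socle diff_self)
  qed
  moreover have "p - const ?c * mon ?s \<in> carrier (mpoly_ring n)"
    by (intro diff_in_carrier mult_in_carrier const_in_carrier single_in_carrier p s)
  ultimately show ?thesis by (simp add: annihilator_def)
qed

lemma origin_ideal_mult_socle:
  assumes n: "n \<ge> 2" and q: "q \<in> origin_ideal n"
  shows "q * mon (Poly_Mapping.single 1 (2 * (n - 2))) \<in>
    (annihilator n (top_weight n) :: 'a::comm_ring_1 mpoly set)"
proof -
  let ?s = "Poly_Mapping.single 1 (2 * (n - 2)) :: nat \<Rightarrow>\<^sub>0 nat"
  have I: "ideal (annihilator n (top_weight n) :: 'a mpoly set) (mpoly_ring n)"
    by (rule ideal_annihilator)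
  have "mon ?s * Poly_Mapping.single m (lookup q m) \<in> annihilator n (top_weight n)" if m: "m \<in> keys q" for m
  proof -
    have "m \<noteq> 0" "m \<in> exponents n"
      using q m by (auto simp: origin_ideal_def carrier_mpoly_ring in_keys_iff)
    then have "mon (?s + m) \<in> (annihilator n (top_weight n) :: 'a mpoly set)"
      using n by (intro high_degree_in_annihilator)
        (auto simp: single_in_exponents monom_degree_add monom_degree_eq_0 simp flip: neq0_conv)
    from ideal_scale[OF I this] show ?thesis by (simp add: mult_single)
  qed
  then have "(\<Sum>m\<in>keys q. mon ?s * Poly_Mapping.single m (lookup q m)) \<in> annihilator n (top_weight n)"
    by (rule ideal_sum[OF I])
  then have "mon ?s * q \<in> annihilator n (top_weight n)"
    by (simp only: sum_distrib_left[symmetric] sum_monomials)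
  then show ?thesis by (simp only: mult.commute)
qed

lemma socle_generator_not_in_annihilator:
  "mon (Poly_Mapping.single 1 (2 * (n - 2))) \<notin> (annihilator n (top_weight n) :: 'a::comm_ring_1 mpoly set)"
proof
  assume "mon (Poly_Mapping.single 1 (2 * (n - 2))) \<in> (annihilator n (top_weight n) :: 'a mpoly set)"
  from linform_annihilator_mult[OF this one_in_carrier] show False
    using top_weight_socle[of n 0, where ?'a = 'a] by simp
qed

section \<open>The height of the ideal of the origin\<close>

definition box :: "nat \<Rightarrow> nat \<Rightarrow> (nat \<Rightarrow>\<^sub>0 nat) set" where
  "box n B = {m \<in> exponents n. \<forall>i. lookup m i \<le> B}"

lemma finite_box_card_le: "finite (box n B) \<and> card (box n B) \<le> (B + 1) ^ n"
proof -
  let ?f = "\<lambda>m. restrict (lookup m) {1..n}"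
  have inj: "inj_on ?f (box n B)"
  proof (rule inj_onI, rule poly_mapping_eqI)
    fix a b i assume ab: "a \<in> box n B" "b \<in> box n B" "?f a = ?f b"
    show "lookup a i = lookup b i"
    proof (cases "i \<in> {1..n}")
      case True
      then show ?thesis using fun_cong[OF ab(3), of i] by simp
    next
      case False
      then have "i \<notin> keys a" "i \<notin> keys b" using ab(1,2) unfolding box_def exponents_def by blast+
      then show ?thesis by (simp add: in_keys_iff)
    qed
  qed
  have sub: "?f ` box n B \<subseteq> {1..n} \<rightarrow>\<^sub>E {..B}" by (auto simp: box_def)
  have fin: "finite ({1..n} \<rightarrow>\<^sub>E {..B})" by (intro finite_PiE) auto
  have "card (box n B) = card (?f ` box n B)" using card_image[OF inj] by simp
  also have "\<dots> \<le> card ({1..n} \<rightarrow>\<^sub>E {..B})" by (rule card_mono[OF fin sub])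
  also have "\<dots> = (B + 1) ^ n" by (simp add: card_PiE)
  finally show ?thesis using finite_imageD[OF finite_subset[OF sub fin] inj] by simp
qed

lemma keys_mult_box:
  assumes "keys p \<subseteq> box n B" "keys q \<subseteq> box n C"
  shows "keys (p * q) \<subseteq> box n (B + C)"
proof
  fix m assume "m \<in> keys (p * q)"
  then obtain a b where "a \<in> keys p" "b \<in> keys q" "m = a + b" using keys_mult[of p q] by blast
  then show "m \<in> box n (B + C)" using assms by (auto simp: box_def lookup_add intro!: add_mono)
qed

lemma keys_power_box: "keys p \<subseteq> box n B \<Longrightarrow> keys (p ^ e) \<subseteq> box n (e * B)"
proof (induction e)
  case (Suc e)
  then show ?case using keys_mult_box[of p n B "p ^ e" "e * B"] by simp
qed (simp add: box_def)

lemma keys_prod_box: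
  "(\<And>i. i \<in> S \<Longrightarrow> keys (f i) \<subseteq> box n (B i)) \<Longrightarrow> keys (\<Prod>i\<in>S. f i) \<subseteq> box n (\<Sum>i\<in>S. B i)"
  by (induction S rule: infinite_finite_induct) (auto simp: box_def[of n 0] keys_mult_box)

lemma box_mono: "B \<le> C \<Longrightarrow> box n B \<subseteq> box n C"
  by (auto simp: box_def intro: order_trans)

lemma carrier_in_box: "p \<in> carrier (mpoly_ring n) \<Longrightarrow> \<exists>B. keys p \<subseteq> box n B"
proof -
  assume p: "p \<in> carrier (mpoly_ring n)"
  have "lookup m i \<le> (\<Sum>m\<in>keys p. monom_degree m)" if m: "m \<in> keys p" for m i
  proof -
    have "lookup m i \<le> monom_degree m"
      by (cases "i \<in> keys m") (auto simp: monom_degree_def in_keys_iff intro: member_le_sum)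
    also have "\<dots> \<le> (\<Sum>m\<in>keys p. monom_degree m)" using m by (intro member_le_sum) auto
    finally show ?thesis .
  qed
  then show ?thesis using p by (intro exI) (auto simp: box_def carrier_mpoly_ring)
qed

lemma vector_space_mpoly: "vector_space (\<lambda>(c :: 'a::field) (p :: 'a mpoly). const c * p)"
  by unfold_locales (simp_all add: distrib_left distrib_right single_add mult_single flip: mult.assoc)

lemma box_span:
  fixes p :: "'a::field mpoly"
  assumes "keys p \<subseteq> S"
  shows "p \<in> module.span (\<lambda>c p. const c * p) (mon ` S)"
proof -
  interpret vector_space "\<lambda>(c :: 'a) (p :: 'a mpoly). const c * p" by (rule vector_space_mpoly)
  have "Poly_Mapping.single m (lookup p m) \<in> span (mon ` S)" if "m \<in> keys p" for m
  proof -
    have "const (lookup p m) * mon m \<in> span (mon ` S)"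
      using that assms by (intro span_scale span_base) auto
    then show ?thesis by (simp add: mult_single)
  qed
  then have "(\<Sum>m\<in>keys p. Poly_Mapping.single m (lookup p m)) \<in> span (mon ` S)" by (rule span_sum)
  then show ?thesis by (simp add: sum_monomials)
qed

text \<open>
  The family is indexed, since repeated members also count as a dependence; this case is
  treated separately because linear independence in \<^locale>\<open>vector_space\<close> is a property of sets.
\<close>

lemma linear_dependence_of_large_family:
  fixes v :: "'b \<Rightarrow> 'a::field mpoly"
  assumes "finite F" "finite S" "card S < card F" "\<And>a. a \<in> F \<Longrightarrow> keys (v a) \<subseteq> S"
  obtains E c where "finite E" "E \<noteq> {}" "E \<subseteq> F" "\<forall>a\<in>E. c a \<noteq> 0"
    "(\<Sum>a\<in>E. const (c a) * v a) = 0"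
proof (cases "inj_on v F")
  case False
  then obtain a b where ab: "a \<in> F" "b \<in> F" "a \<noteq> b" "v a = v b" by (auto simp: inj_on_def)
  then have "(\<Sum>x\<in>{a, b}. const (if x = a then 1 else - 1) * v x) = 0"
    by (simp add: single_uminus)
  then show ?thesis using ab by (intro that[of "{a, b}" "\<lambda>x. if x = a then 1 else - 1"]) auto
next
  case True
  interpret vector_space "\<lambda>(c :: 'a) (p :: 'a mpoly). const c * p" by (rule vector_space_mpoly)
  have "v ` F \<subseteq> span (mon ` S)" using assms(4) box_span by blast
  moreover have "card (mon ` S :: 'a mpoly set) < card (v ` F)"
    using card_image_le[OF assms(2), of "mon :: _ \<Rightarrow> 'a mpoly"] assms(3) card_image[OF True] by simp
  ultimately have "dependent (v ` F)"
    using independent_span_bound[of "mon ` S" "v ` F"] assms(2) by force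
  then obtain T u where T: "finite T" "T \<subseteq> v ` F" "(\<Sum>x\<in>T. const (u x) * x) = 0" "\<exists>x\<in>T. u x \<noteq> 0"
    unfolding dependent_explicit by blast
  define E where "E = {a \<in> F. v a \<in> T \<and> u (v a) \<noteq> 0}"
  have "(\<Sum>a\<in>E. const (u (v a)) * v a) = (\<Sum>x\<in>v ` E. const (u x) * x)"
    using True by (subst sum.reindex) (auto simp: E_def inj_on_def)
  also have "\<dots> = (\<Sum>x\<in>T. const (u x) * x)"
  proof (rule sum.mono_neutral_left)
    show "\<forall>x\<in>T - v ` E. const (u x) * x = 0"
    proof
      fix x assume x: "x \<in> T - v ` E"
      then obtain a where "a \<in> F" "x = v a" using T(2) by blast
      then have "u x = 0" using x by (auto simp: E_def)
      then show "const (u x) * x = 0" by simp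
    qed
  qed (use T(1) in \<open>auto simp: E_def\<close>)
  finally have "(\<Sum>a\<in>E. const (u (v a)) * v a) = 0" using T(3) by simp
  moreover have "finite E" "E \<noteq> {}" "E \<subseteq> F" using assms(1) T(2,4) by (auto simp: E_def)
  ultimately show ?thesis by (intro that[of E "\<lambda>a. u (v a)"]) (auto simp: E_def)
qed

text \<open>
  There are \<open>D\<^sup>k\<close> power products of the \<open>y\<^sub>i\<close> with exponents below \<open>D\<close>, and their
  exponents in \<open>x\<^sub>1, \<dots>, x\<^sub>n\<close> are bounded by a constant multiple of \<open>D\<close>, which leaves
  at most a constant times \<open>D\<^sup>n\<close> monomials. For large \<open>D\<close> the former number exceeds the latter.
  
  Exponent tuples are extensional functions on \<open>{..<k}\<close> so that tuples with equal entries are equal.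
\<close>

lemma algebraic_dependence:
  fixes y :: "nat \<Rightarrow> 'a::field mpoly"
  assumes y: "\<And>i. i < k \<Longrightarrow> y i \<in> carrier (mpoly_ring n)" and k: "n < k"
  obtains E c where "finite E" "E \<noteq> {}" "E \<subseteq> {..<k} \<rightarrow>\<^sub>E (UNIV :: nat set)" "\<forall>a\<in>E. c a \<noteq> 0"
    "(\<Sum>a\<in>E. const (c a) * (\<Prod>i<k. y i ^ a i)) = 0"
proof -
  have "\<forall>i\<in>{..<k}. \<exists>B. keys (y i) \<subseteq> box n B" using carrier_in_box y by blast
  then obtain B where B: "\<And>i. i < k \<Longrightarrow> keys (y i) \<subseteq> box n (B i)" by (metis lessThan_iff)
  define \<delta> where "\<delta> = (\<Sum>i<k. B i)"
  \<comment> \<open>Large enough for \<open>(D (\<delta> + 1))\<^sup>n < D\<^sup>n\<^sup>+\<^sup>1\<close>, where \<open>\<delta>\<close> bounds the exponents in the product of the \<open>y\<^sub>i\<close>.\<close>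
  define D where "D = (\<delta> + 1) ^ n + 1"
  define F where "F = {..<k} \<rightarrow>\<^sub>E {..<D}"
  have keys: "keys (\<Prod>i<k. y i ^ a i) \<subseteq> box n (D * \<delta>)" if a: "a \<in> F" for a
  proof -
    have "keys (\<Prod>i<k. y i ^ a i) \<subseteq> box n (\<Sum>i<k. a i * B i)"
      by (intro keys_prod_box keys_power_box B) simp
    moreover have "(\<Sum>i<k. a i * B i) \<le> D * \<delta>" unfolding \<delta>_def sum_distrib_left
      using a by (intro sum_mono mult_right_mono) (auto simp: F_def PiE_def Pi_def intro: less_imp_le)
    ultimately show ?thesis using box_mono by blast
  qed
  have D: "(\<delta> + 1) ^ n < D" "D \<ge> 1" by (simp_all add: D_def)
  have "card (box n (D * \<delta>)) \<le> (D * \<delta> + 1) ^ n" using finite_box_card_le by blast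
  also have "\<dots> \<le> (D * (\<delta> + 1)) ^ n" 
    using D(2) by (intro power_mono) (simp_all add: distrib_left)
  also have "\<dots> < D * D ^ n"
    unfolding power_mult_distrib using D by (subst mult.commute[of D]) (intro mult_strict_left_mono, auto)
  also have "\<dots> \<le> D ^ k" using power_increasing[of "Suc n" k D] k D(2) by simp
  also have "\<dots> = card F" by (simp add: F_def card_PiE)
  finally have card: "card (box n (D * \<delta>)) < card F" .
  have "finite F" by (auto simp: F_def intro: finite_PiE)
  moreover have "finite (box n (D * \<delta>))" using finite_box_card_le by blast
  ultimately show ?thesis
  proof (rule linear_dependence_of_large_family[of F "box n (D * \<delta>)" "\<lambda>a. \<Prod>i<k. y i ^ a i"])
    show "card (box n (D * \<delta>)) < card F" by (rule card)
    show "keys (\<Prod>i<k. y i ^ a i) \<subseteq> box n (D * \<delta>)" if "a \<in> F" for a by (rule keys[OF that])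
  next
    fix E c assume E: "finite E" "E \<noteq> {}" "E \<subseteq> F" "\<forall>a\<in>E. c a \<noteq> 0"
      "(\<Sum>a\<in>E. const (c a) * (\<Prod>i<k. y i ^ a i)) = 0"
    have "F \<subseteq> {..<k} \<rightarrow>\<^sub>E UNIV" by (auto simp: F_def)
    with E(3) have "E \<subseteq> {..<k} \<rightarrow>\<^sub>E UNIV" by (rule subset_trans)
    from that[OF E(1,2) this E(4,5)] show ?thesis .
  qed
qed

text \<open>
  Take from a relation those terms whose exponents of \<open>y\<^sub>0\<close> are minimal, and among the
  remaining factors proceed likewise with \<open>y\<^sub>1, y\<^sub>2, \<dots>\<close>. Passing from \<open>Q\<^sub>l\<close> to \<open>Q\<^sub>l\<^sub>+\<^sub>1\<close>, the lowest power of
  \<open>y\<^sub>l\<close> can be cancelled since \<open>y\<^sub>l\<close> is not in the prime \<open>Q\<^sub>l\<close>, and the terms in which \<open>y\<^sub>l\<close> survives lie in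
  \<open>Q\<^sub>l\<^sub>+\<^sub>1\<close>. In the end a single nonzero constant is left in \<open>Q\<^sub>k\<close>.
\<close>

lemma no_relation_along_prime_chain:
  fixes y :: "nat \<Rightarrow> 'a::field mpoly"
  assumes Q: "\<And>i. i \<le> k \<Longrightarrow> primeideal (Q i) (mpoly_ring n)"
    and mono: "\<And>i. i < k \<Longrightarrow> Q i \<subseteq> Q (Suc i)"
    and y: "\<And>i. i < k \<Longrightarrow> y i \<in> Q (Suc i)" "\<And>i. i < k \<Longrightarrow> y i \<notin> Q i"
    and E: "finite E" "E \<noteq> {}" "E \<subseteq> {..<k} \<rightarrow>\<^sub>E (UNIV :: nat set)" "\<forall>a\<in>E. c a \<noteq> 0"
  shows "(\<Sum>a\<in>E. const (c a) * (\<Prod>i<k. y i ^ a i)) \<noteq> 0"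
proof
  assume rel: "(\<Sum>a\<in>E. const (c a) * (\<Prod>i<k. y i ^ a i)) = 0"
  have I: "ideal (Q i) (mpoly_ring n)" if "i \<le> k" for i
    using Q[OF that] by (rule primeideal.axioms(1))
  have yc: "y i \<in> carrier (mpoly_ring n)" if "i < k" for i
    using ideal_subset_carrier[OF I[of "Suc i"]] y(1)[OF that] that by auto
  have powc: "p ^ e \<in> carrier (mpoly_ring n)" if "p \<in> carrier (mpoly_ring n)" for p :: "'a mpoly" and e
    using that by (induction e) (auto intro: mult_in_carrier one_in_carrier)
  have prodc: "(\<Prod>i\<in>S. f i) \<in> carrier (mpoly_ring n)"
    if "\<And>i. i \<in> S \<Longrightarrow> f i \<in> carrier (mpoly_ring n)" for S :: "nat set" and f :: "nat \<Rightarrow> 'a mpoly"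
    using that by (induction S rule: infinite_finite_induct)
      (auto intro: mult_in_carrier one_in_carrier)
  have sumc: "(\<Sum>a\<in>S. f a) \<in> carrier (mpoly_ring n)"
    if "\<And>a. a \<in> S \<Longrightarrow> f a \<in> carrier (mpoly_ring n)" for S :: "(nat \<Rightarrow> nat) set" and f :: "_ \<Rightarrow> 'a mpoly"
    using that by (induction S rule: infinite_finite_induct)
      (auto intro: add_in_carrier zero_in_carrier)
  have cancel: "p \<in> Q l" if "l < k" "y l ^ e * p \<in> Q l" "p \<in> carrier (mpoly_ring n)" for l e p
    using that(2)
  proof (induction e)
    case (Suc e)
    then have "y l \<in> Q l \<or> y l ^ e * p \<in> Q l"
      using primeideal.I_prime[OF Q[of l], of "y l" "y l ^ e * p"] that yc powc
      by (auto simp: mult.assoc intro: mult_in_carrier)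
    then show ?case using Suc.IH y(2)[OF that(1)] by blast
  qed simp
  have "\<exists>G\<subseteq>E. G \<noteq> {} \<and> (\<forall>a\<in>G. \<forall>b\<in>G. \<forall>i<l. a i = b i) \<and>
    (\<Sum>a\<in>G. const (c a) * (\<Prod>i\<in>{l..<k}. y i ^ a i)) \<in> Q l" if "l \<le> k" for l
    using that
  proof (induction l)
    case 0
    then show ?case using E(2) rel ideal_zero[OF I[of 0]]
      by (intro exI[of _ E]) (simp add: atLeast0LessThan)
  next
    case (Suc l)
    then obtain G where G: "G \<subseteq> E" "G \<noteq> {}" "\<forall>a\<in>G. \<forall>b\<in>G. \<forall>i<l. a i = b i"
      and sum: "(\<Sum>a\<in>G. const (c a) * (\<Prod>i\<in>{l..<k}. y i ^ a i)) \<in> Q l" by auto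
    have finG: "finite G" using G(1) E(1) finite_subset by blast
    have l: "l < k" using Suc.prems by simp
    let ?J = "Q (Suc l)"
    have J: "ideal ?J (mpoly_ring n)" using I l by simp
    \<comment> \<open>\<open>G\<close> collects the terms kept so far, \<open>H\<close> those with the least exponent \<open>e\<close> of \<open>y\<^sub>l\<close>.\<close>
    define e where "e = Min ((\<lambda>a. a l) ` G)"
    define H where "H = {a \<in> G. a l = e}"
    define t where "t a = const (c a) * (\<Prod>i\<in>{Suc l..<k}. y i ^ a i)" for a
    have e_le: "e \<le> a l" if "a \<in> G" for a using that finG by (simp add: e_def)
    have tc: "t a \<in> carrier (mpoly_ring n)" for a
      unfolding t_def using yc by (intro mult_in_carrier const_in_carrier prodc powc) auto
    have "e \<in> (\<lambda>a. a l) ` G" unfolding e_def using finG G(2) by (intro Min_in) auto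
    then have Hne: "H \<noteq> {}" by (auto simp: H_def)
    have "const (c a) * (\<Prod>i\<in>{l..<k}. y i ^ a i) = y l ^ e * (y l ^ (a l - e) * t a)" if "a \<in> G" for a
    proof -
      have "y l ^ a l = y l ^ e * y l ^ (a l - e)" using e_le[OF that] by (simp flip: power_add)
      then show ?thesis using l by (simp add: prod.atLeast_Suc_lessThan t_def mult_ac)
    qed
    then have "y l ^ e * (\<Sum>a\<in>G. y l ^ (a l - e) * t a) \<in> Q l"
      using sum by (simp add: sum_distrib_left)
    then have "(\<Sum>a\<in>G. y l ^ (a l - e) * t a) \<in> Q l"
      by (rule cancel[OF l]) (intro sumc mult_in_carrier powc yc l tc)
    then have 1: "(\<Sum>a\<in>G. y l ^ (a l - e) * t a) \<in> ?J" using mono[OF l] by blast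
    have "y l ^ (a l - e) * t a \<in> ?J" if "a \<in> G - H" for a
    proof -
      have "a l - e \<noteq> 0" using that e_le[of a] by (auto simp: H_def)
      then obtain d where d: "a l - e = Suc d" by (cases "a l - e") auto
      have "(y l ^ d * t a) * y l \<in> ?J"
        using l by (intro ideal_mult[OF J] y mult_in_carrier powc yc tc)
      then show ?thesis by (simp add: d mult_ac)
    qed
    then have 2: "(\<Sum>a\<in>G - H. y l ^ (a l - e) * t a) \<in> ?J" by (rule ideal_sum[OF J])
    have "(\<Sum>a\<in>G. y l ^ (a l - e) * t a) = (\<Sum>a\<in>G - H. y l ^ (a l - e) * t a) + (\<Sum>a\<in>H. y l ^ (a l - e) * t a)"
      using finG by (intro sum.subset_diff) (auto simp: H_def)
    moreover have "(\<Sum>a\<in>H. y l ^ (a l - e) * t a) = (\<Sum>a\<in>H. t a)" by (simp add: H_def)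
    ultimately have "(\<Sum>a\<in>H. t a) \<in> ?J" using ideal_diff[OF J 1 2] by simp
    moreover have "\<forall>a\<in>H. \<forall>b\<in>H. \<forall>i<Suc l. a i = b i"
      using G(3) by (auto simp: H_def less_Suc_eq)
    ultimately show ?case using G(1) Hne by (intro exI[of _ H]) (auto simp: H_def t_def)
  qed
  from this[OF order_refl] obtain G where G: "G \<subseteq> E" "G \<noteq> {}" "\<forall>a\<in>G. \<forall>b\<in>G. \<forall>i<k. a i = b i"
    and sum: "(\<Sum>a\<in>G. const (c a)) \<in> Q k" by auto
  obtain a where a: "a \<in> G" using G(2) by blast
  have "b = a" if "b \<in> G" for b
    using that a G(1,3) E(3) by (intro PiE_ext[of b "{..<k}" "\<lambda>_. UNIV" a]) auto
  then have "G = {a}" using a by blast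
  then have "const (c a) \<in> Q k" using sum by simp
  from ideal_mult[OF I[OF order_refl] this const_in_carrier[of "inverse (c a)"]]
  have "1 \<in> Q k" using E(4) a G(1) by (auto simp: mult_single)
  then have "q \<in> Q k" if "q \<in> carrier (mpoly_ring n)" for q
    using ideal_mult[OF I[OF order_refl], of 1 q] that by simp
  then have "Q k = carrier (mpoly_ring n)" using ideal_subset_carrier[OF I[OF order_refl]] by blast
  then show False using primeideal.I_notcarr[OF Q[OF order_refl]] by simp
qed

lemma prime_chain_length:
  fixes Q :: "nat \<Rightarrow> 'a::field mpoly set"
  assumes Q: "\<And>i. i \<le> k \<Longrightarrow> primeideal (Q i) (mpoly_ring n)"
    and mono: "\<And>i. i < k \<Longrightarrow> Q i \<subset> Q (Suc i)"
  shows "k \<le> n"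
proof (rule ccontr)
  assume "\<not> k \<le> n"
  have "\<forall>i\<in>{..<k}. \<exists>y. y \<in> Q (Suc i) \<and> y \<notin> Q i" using mono by blast
  then obtain y where y: "\<And>i. i < k \<Longrightarrow> y i \<in> Q (Suc i) \<and> y i \<notin> Q i" by (metis lessThan_iff)
  have yc: "y i \<in> carrier (mpoly_ring n)" if "i < k" for i
    using ideal_subset_carrier[OF primeideal.axioms(1)[OF Q[of "Suc i"]]] y that by auto
  obtain E c where E: "finite E" "E \<noteq> {}" "E \<subseteq> {..<k} \<rightarrow>\<^sub>E (UNIV :: nat set)" "\<forall>a\<in>E. c a \<noteq> 0"
    "(\<Sum>a\<in>E. const (c a) * (\<Prod>i<k. y i ^ a i)) = 0"
    by (rule algebraic_dependence[of k y n]) (use yc \<open>\<not> k \<le> n\<close> in auto)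
  have "(\<Sum>a\<in>E. const (c a) * (\<Prod>i<k. y i ^ a i)) \<noteq> 0"
  proof (rule no_relation_along_prime_chain[of k Q n y E c])
    show "Q i \<subseteq> Q (Suc i)" if "i < k" for i using mono[OF that] by blast
    show "y i \<in> Q (Suc i)" "y i \<notin> Q i" if "i < k" for i using y[OF that] by blast+
  qed (rule Q E; assumption)+
  then show False using E(5) by contradiction
qed

text \<open>
  The ideal \<open>(x\<^sub>1, \<dots>, x\<^sub>k)\<close>: being a monomial ideal, it is determined by the monomials it contains.
\<close>

definition coordinate_ideal :: "nat \<Rightarrow> nat \<Rightarrow> 'a::comm_ring_1 mpoly set" where
  "coordinate_ideal n k = {p \<in> carrier (mpoly_ring n). \<forall>m\<in>keys p. keys m \<inter> {1..k} \<noteq> {}}"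

lemma ideal_coordinate_ideal:
  "ideal (coordinate_ideal n k :: 'a::comm_ring_1 mpoly set) (mpoly_ring n)"
proof (rule ideal_mpoly_ringI)
  fix p q :: "'a mpoly"
  assume p: "p \<in> coordinate_ideal n k" and q: "q \<in> coordinate_ideal n k"
  then have "\<forall>m\<in>keys p \<union> keys q. keys m \<inter> {1..k} \<noteq> {}" by (auto simp: coordinate_ideal_def)
  then have "\<forall>m\<in>keys (p + q). keys m \<inter> {1..k} \<noteq> {}" using Poly_Mapping.keys_add[of p q] by blast
  then show "p + q \<in> coordinate_ideal n k"
    using p q add_in_carrier[of p n q] by (simp add: coordinate_ideal_def)
next
  fix p q :: "'a mpoly"
  assume p: "p \<in> coordinate_ideal n k" and q: "q \<in> carrier (mpoly_ring n)"
  have "keys m \<inter> {1..k} \<noteq> {}" if "m \<in> keys (q * p)" for m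
  proof -
    obtain a b where "b \<in> keys p" "m = a + b" using \<open>m \<in> keys (q * p)\<close> keys_mult[of q p] by blast
    then have "keys b \<inter> {1..k} \<noteq> {}" "keys b \<subseteq> keys m"
      using p by (simp_all add: coordinate_ideal_def keys_add_nat)
    then show ?thesis by blast
  qed
  then show "q * p \<in> coordinate_ideal n k"
    using p mult_in_carrier[OF q, of p] by (simp add: coordinate_ideal_def)
qed (auto simp: coordinate_ideal_def carrier_mpoly_ring)

text \<open>
  Modulo this ideal every polynomial is congruent to its part without \<open>x\<^sub>1, \<dots>, x\<^sub>k\<close>. The product
  of two such parts again avoids these variables, so it is zero if it lies in the ideal, and polynomials have no
  zero divisors.
\<close>

lemma primeideal_coordinate_ideal:
  "primeideal (coordinate_ideal n k :: 'a::idom mpoly set) (mpoly_ring n)"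
proof (rule primeidealI[OF ideal_coordinate_ideal cring_mpoly_ring])
  have "1 \<in> carrier (mpoly_ring n)" "1 \<notin> (coordinate_ideal n k :: 'a mpoly set)"
    by (simp_all add: coordinate_ideal_def carrier_mpoly_ring)
  then show "carrier (mpoly_ring n) \<noteq> (coordinate_ideal n k :: 'a mpoly set)" by blast
next
  fix p q :: "'a mpoly"
  assume p: "p \<in> carrier (mpoly_ring n)" and q: "q \<in> carrier (mpoly_ring n)"
    and pq: "p \<otimes>\<^bsub>mpoly_ring n\<^esub> q \<in> coordinate_ideal n k"
  have I: "ideal (coordinate_ideal n k :: 'a mpoly set) (mpoly_ring n)"
    by (rule ideal_coordinate_ideal)
  define red :: "'a mpoly \<Rightarrow> 'a mpoly" where
    "red r = (\<Sum>m\<in>{m \<in> keys r. keys m \<inter> {1..k} = {}}. Poly_Mapping.single m (lookup r m))" for r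
  have look: "lookup (red r) m = (if keys m \<inter> {1..k} = {} then lookup r m else 0)" for r m
    by (simp add: red_def lookup_sum lookup_single when_def in_keys_iff)
  have redc: "red r \<in> carrier (mpoly_ring n)" if "r \<in> carrier (mpoly_ring n)" for r
    using that by (auto simp: carrier_mpoly_ring in_keys_iff look split: if_splits)
  have diff: "r - red r \<in> coordinate_ideal n k" if "r \<in> carrier (mpoly_ring n)" for r
    using diff_in_carrier[OF that redc[OF that]]
    by (auto simp: coordinate_ideal_def in_keys_iff lookup_minus look split: if_splits)
  have "red p * red q = p * q - (q * (p - red p) + red p * (q - red q))"
    by (simp add: algebra_simps)
  also have "\<dots> \<in> coordinate_ideal n k"
    using pq ideal_add[OF I ideal_mult[OF I diff[OF p] q] ideal_mult[OF I diff[OF q] redc[OF p]]]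
    by (intro ideal_diff[OF I]) simp_all
  finally have mem: "red p * red q \<in> coordinate_ideal n k" .
  have "keys (red p * red q) = {}"
  proof (rule ccontr)
    assume "keys (red p * red q) \<noteq> {}"
    then obtain m where m: "m \<in> keys (red p * red q)" by blast
    then obtain a b where ab: "a \<in> keys (red p)" "b \<in> keys (red q)" "m = a + b"
      using keys_mult[of "red p" "red q"] by blast
    then have "keys a \<inter> {1..k} = {}" "keys b \<inter> {1..k} = {}"
      by (simp_all add: in_keys_iff[of _ "red _"] look split: if_splits)
    then have "keys m \<inter> {1..k} = {}" by (auto simp: ab(3) keys_add_nat)
    then show False using mem m by (auto simp: coordinate_ideal_def)
  qed
  then have "red p * red q = 0" by simp
  then have "red p = 0 \<or> red q = 0" by simp
  then show "p \<in> coordinate_ideal n k \<or> q \<in> coordinate_ideal n k"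
    using diff[OF p] diff[OF q] by auto
qed

lemma coordinate_ideal_strict:
  assumes "k < n"
  shows "coordinate_ideal n k \<subset> (coordinate_ideal n (Suc k) :: 'a::comm_ring_1 mpoly set)"
proof
  show "coordinate_ideal n k \<subseteq> (coordinate_ideal n (Suc k) :: 'a mpoly set)"
    by (fastforce simp: coordinate_ideal_def)
  have "mon (Poly_Mapping.single (Suc k) 1) \<in> (coordinate_ideal n (Suc k) :: 'a mpoly set)"
    "mon (Poly_Mapping.single (Suc k) 1) \<notin> (coordinate_ideal n k :: 'a mpoly set)"
    using assms by (auto simp: coordinate_ideal_def carrier_mpoly_ring single_in_exponents)
  then show "coordinate_ideal n k \<noteq> (coordinate_ideal n (Suc k) :: 'a mpoly set)" by blast
qed

lemma coordinate_ideal_origin: "coordinate_ideal n n = origin_ideal n"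
proof -
  have "(\<forall>m\<in>keys p. keys m \<inter> {1..n} \<noteq> {}) \<longleftrightarrow> lookup p 0 = 0"
    if p: "p \<in> carrier (mpoly_ring n)" for p :: "'a mpoly"
  proof -
    have "keys m \<inter> {1..n} = keys m" if "m \<in> keys p" for m
      using that p by (auto simp: carrier_mpoly_ring exponents_def)
    then have "(\<forall>m\<in>keys p. keys m \<inter> {1..n} \<noteq> {}) \<longleftrightarrow> (\<forall>m\<in>keys p. m \<noteq> 0)" by simp
    then show ?thesis by (auto simp: in_keys_iff)
  qed
  then show ?thesis by (auto simp: coordinate_ideal_def origin_ideal_def)
qed

lemma prime_height_origin_ideal:
  "prime_height (mpoly_ring n) (origin_ideal n :: 'a::field mpoly set) = enat n"
  unfolding prime_height_def
proof (rule antisym)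
  show "Sup {enat k |k. \<exists>Q :: nat \<Rightarrow> 'a mpoly set. (\<forall>i\<le>k. primeideal (Q i) (mpoly_ring n)) \<and>
      (\<forall>i<k. Q i \<subset> Q (Suc i)) \<and> Q k = origin_ideal n} \<le> enat n"
  proof (rule Sup_least, clarify)
    fix k and Q :: "nat \<Rightarrow> 'a mpoly set"
    assume "\<forall>i\<le>k. primeideal (Q i) (mpoly_ring n)" "\<forall>i<k. Q i \<subset> Q (Suc i)"
    then show "enat k \<le> enat n" using prime_chain_length[of k Q n] by simp
  qed
  have "\<exists>Q :: nat \<Rightarrow> 'a mpoly set. (\<forall>i\<le>n. primeideal (Q i) (mpoly_ring n)) \<and>
      (\<forall>i<n. Q i \<subset> Q (Suc i)) \<and> Q n = origin_ideal n"
    by (intro exI[of _ "coordinate_ideal n"])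
      (simp add: primeideal_coordinate_ideal coordinate_ideal_strict coordinate_ideal_origin)
  then show "enat n \<le> Sup {enat k |k. \<exists>Q :: nat \<Rightarrow> 'a mpoly set. (\<forall>i\<le>k. primeideal (Q i) (mpoly_ring n)) \<and>
      (\<forall>i<k. Q i \<subset> Q (Suc i)) \<and> Q k = origin_ideal n}"
    by (intro Sup_upper) blast
qed

lemma codimension_annihilator:
  assumes "n \<ge> 2"
  shows "codimension (mpoly_ring n) (annihilator n (top_weight n) :: 'a::field mpoly set) = enat n"
proof -
  have "primeideal P (mpoly_ring n) \<and> annihilator n (top_weight n) \<subseteq> P \<longleftrightarrow> P = origin_ideal n"
    for P :: "'a mpoly set"
    using prime_over_annihilator annihilator_subset_origin_ideal[OF assms]
      cring.maximalideal_prime[OF cring_mpoly_ring maximalideal_origin_ideal] by blast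
  then show ?thesis by (simp add: codimension_def prime_height_origin_ideal)
qed

section \<open>The quotient ring\<close>

text \<open>
  The ambient space may have infinite dimension; it is the finite spanning set \<open>B\<close> that
  makes dimensions comparable.
\<close>

lemma (in vector_space) subspace_eq_if_dim_eq:
  assumes "finite B" "subspace U" "U \<subseteq> V" "V \<subseteq> span B"
  shows "dim U \<le> dim V" "dim U = dim V \<Longrightarrow> U = V"
proof -
  obtain b where b: "b \<subseteq> U" "independent b" "U \<subseteq> span b" using maximal_independent_subset by blast
  then obtain c where c: "b \<subseteq> c" "c \<subseteq> V" "independent c" "V \<subseteq> span c"
    using maximal_independent_subset_extend[of b V] assms(3) by blast
  have fin: "finite c" using independent_span_bound[OF assms(1) c(3)] c(2) assms(4) by blast
  have dims: "dim U = card b" "dim V = card c"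
    using basis_card_eq_dim[OF b(1) b(3) b(2)] basis_card_eq_dim[OF c(2) c(4) c(3)] by simp_all
  show "dim U \<le> dim V" using dims card_mono[OF fin c(1)] by simp
  assume "dim U = dim V"
  then have "b = c" using card_subset_eq[OF fin c(1)] dims by simp
  then have "V \<subseteq> U" using c(4) b(1) span_minimal[OF b(1) assms(2)] by blast
  then show "U = V" using assms(3) by blast
qed

lemma (in vector_space) subspace_chain_stabilizes:
  fixes U :: "nat \<Rightarrow> _"
  assumes "finite B" "\<And>i. subspace (U i)" "\<And>i. U i \<subseteq> span B" "\<And>i. U (Suc i) \<subseteq> U i"
  shows "\<exists>m. \<forall>i\<ge>m. U i = U m"
proof -
  obtain m where m: "\<And>i. dim (U m) \<le> dim (U i)"
    using ex_has_least_nat[of "\<lambda>_. True" 0 "\<lambda>i. dim (U i)"] by blast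
  have "U i = U m" if "i \<ge> m" for i
  proof -
    have sub: "U i \<subseteq> U m" using assms(4) that by (rule lift_Suc_antimono_le)
    show ?thesis
      using subspace_eq_if_dim_eq[OF assms(1,2) sub assms(3)] m[of i] by simp
  qed
  then show ?thesis by blast
qed

lemma carrier_quot: "carrier (R Quot I) = (+>\<^bsub>R\<^esub>) I ` carrier R"
  by (auto simp: FactRing_def A_RCOSETS_def')

lemma (in ring) quot_ideal_eq_image_Union:
  assumes "ideal I R" "ideal M (R Quot I)"
  shows "ideal (\<Union>M) R" "I \<subseteq> \<Union>M" "M = (+>) I ` \<Union>M"
proof -
  have "M \<in> (\<lambda>J. (+>) I ` J) ` {J. ideal J R \<and> I \<subseteq> J}"
    using bij_betw_imp_surj_on[OF quot_ideal_correspondence[OF assms(1)]] assms(2) by simp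
  then obtain J where J: "ideal J R" "I \<subseteq> J" "M = (+>) I ` J" by blast
  then have "\<Union>M = J" using ideal_incl_iff[OF assms(1) J(1)] by simp
  then show "ideal (\<Union>M) R" "I \<subseteq> \<Union>M" "M = (+>) I ` \<Union>M" using J by simp_all
qed

lemma (in ring) maximalideal_quot_iff:
  assumes I: "ideal I R" and J: "ideal J R" "I \<subseteq> J"
  shows "maximalideal ((+>) I ` J) (R Quot I) \<longleftrightarrow> maximalideal J R"
proof -
  have Un: "\<Union>((+>) I ` L) = L" if "ideal L R" "I \<subseteq> L" for L
    using ideal_incl_iff[OF I that(1)] that(2) by simp
  have car: "ideal (carrier R) R" "I \<subseteq> carrier R"
    using oneideal additive_subgroup.a_subset[OF ideal.axioms(1)[OF I]] by auto
  show ?thesis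
  proof
    assume M: "maximalideal ((+>) I ` J) (R Quot I)"
    show "maximalideal J R"
    proof (rule maximalidealI[OF J(1)])
      show "carrier R \<noteq> J" using maximalideal.I_notcarr[OF M] by (auto simp: carrier_quot)
    next
      fix L assume L: "ideal L R" "J \<subseteq> L" "L \<subseteq> carrier R"
      have IL: "I \<subseteq> L" using J(2) L(2) by blast
      have "(+>) I ` L = (+>) I ` J \<or> (+>) I ` L = carrier (R Quot I)"
        using L by (intro maximalideal.I_maximal[OF M] ring_ideal_imp_quot_ideal I)
          (auto simp: carrier_quot)
      then show "L = J \<or> L = carrier R"
        unfolding carrier_quot using Un[OF L(1) IL] Un[OF J] Un[OF car] by metis
    qed
  next
    assume M: "maximalideal J R"
    show "maximalideal ((+>) I ` J) (R Quot I)"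
    proof (rule maximalidealI[OF ring_ideal_imp_quot_ideal[OF I J(1)]])
      show "carrier (R Quot I) \<noteq> (+>) I ` J"
        unfolding carrier_quot using Un[OF J] Un[OF car] maximalideal.I_notcarr[OF M] by metis
    next
      fix Y assume Y: "ideal Y (R Quot I)" "(+>) I ` J \<subseteq> Y" "Y \<subseteq> carrier (R Quot I)"
      note UY = quot_ideal_eq_image_Union[OF I Y(1)]
      have "\<Union>((+>) I ` J) \<subseteq> \<Union>Y" using Y(2) by blast
      then have "J \<subseteq> \<Union>Y" by (simp only: Un[OF J])
      moreover have "\<Union>Y \<subseteq> carrier R"
        by (rule additive_subgroup.a_subset[OF ideal.axioms(1)[OF UY(1)]])
      ultimately have "\<Union>Y = J \<or> \<Union>Y = carrier R" by (rule maximalideal.I_maximal[OF M UY(1)])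
      then show "Y = (+>) I ` J \<or> Y = carrier (R Quot I)" using UY(3) by (metis carrier_quot)
    qed
  qed
qed

text \<open>
  An ideal that contains \<open>A\<close> contains all monomials of degree above \<open>2 (n - 2)\<close>, so it is determined by its
  elements of degree at most \<open>2 (n - 2)\<close>. These form a subspace of a finite-dimensional space.
\<close>

lemma artinian_quot_annihilator:
  "artinian_ring (mpoly_ring n Quot (annihilator n (top_weight n) :: 'a::field mpoly set))"
  unfolding artinian_ring_def
proof (intro conjI allI impI)
  let ?R = "mpoly_ring n :: 'a mpoly ring"
  let ?A = "annihilator n (top_weight n) :: 'a mpoly set"
  interpret R: cring ?R by (rule cring_mpoly_ring)
  have A: "ideal ?A ?R" by (rule ideal_annihilator)
  show "cring (?R Quot ?A)" by (rule ideal.quotient_is_cring[OF A cring_mpoly_ring])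
  fix J :: "nat \<Rightarrow> 'a mpoly set set"
  assume "(\<forall>i. ideal (J i) (?R Quot ?A)) \<and> (\<forall>i. J (Suc i) \<subseteq> J i)"
  then have J: "\<And>i. ideal (J i) (?R Quot ?A)" and dec: "\<And>i. J (Suc i) \<subseteq> J i" by auto
  define W where "W i = \<Union>(J i)" for i
  have W: "ideal (W i) ?R" "?A \<subseteq> W i" "J i = (+>\<^bsub>?R\<^esub>) ?A ` W i" for i
    unfolding W_def using R.quot_ideal_eq_image_Union[OF A J] by blast+
  define S where "S = {m \<in> exponents n. monom_degree m \<le> 2 * (n - 2)}"
  have "lookup m i \<le> monom_degree m" for m i
    by (cases "i \<in> keys m") (auto simp: monom_degree_def in_keys_iff intro: member_le_sum)
  then have "S \<subseteq> box n (2 * (n - 2))" by (auto simp: S_def box_def intro: order_trans)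
  then have finS: "finite S" using finite_box_card_le finite_subset by blast
  interpret V: vector_space "\<lambda>(c :: 'a) (p :: 'a mpoly). const c * p" by (rule vector_space_mpoly)
  define U where "U i = {p \<in> W i. keys p \<subseteq> S}" for i
  have "\<exists>m. \<forall>i\<ge>m. U i = U m"
  proof (rule V.subspace_chain_stabilizes)
    show "finite (mon ` S :: 'a mpoly set)" using finS by simp
    show "U i \<subseteq> V.span (mon ` S)" for i using box_span by (auto simp: U_def)
    show "U (Suc i) \<subseteq> U i" for i using dec[of i] by (auto simp: U_def W_def)
    show "V.subspace (U i)" for i
    proof (rule V.subspaceI)
      show "0 \<in> U i" using ideal_zero[OF W(1)] by (simp add: U_def)
      show "p + q \<in> U i" if "p \<in> U i" "q \<in> U i" for p q
        using that ideal_add[OF W(1)] Poly_Mapping.keys_add[of p q] unfolding U_def by blast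
      show "const c * p \<in> U i" if "p \<in> U i" for c p
        using that ideal_mult[OF W(1) _ const_in_carrier] keys_mult[of "const c" p]
        unfolding U_def by (fastforce split: if_splits)
    qed
  qed
  then obtain m where m: "\<And>i. i \<ge> m \<Longrightarrow> U i = U m" by blast
  have WU: "W i \<subseteq> W j" if "U i \<subseteq> U j" for i j
  proof
    fix p assume p: "p \<in> W i"
    then have exp: "keys p \<subseteq> exponents n" using ideal_subset_carrier[OF W(1)] by (auto simp: carrier_mpoly_ring)
    define t where "t = (\<Sum>m\<in>keys p \<inter> S. Poly_Mapping.single m (lookup p m))"
    have look: "lookup t m = (if m \<in> S then lookup p m else 0)" for m
      by (simp add: t_def lookup_sum lookup_single when_def in_keys_iff)
    have "(\<Sum>m\<in>keys p - S. Poly_Mapping.single m (lookup p m)) \<in> ?A"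
    proof (rule ideal_sum[OF A], rule ideal_scale[OF A], rule high_degree_in_annihilator)
      fix m assume "m \<in> keys p - S"
      then show "m \<in> exponents n" "2 * (n - 2) < monom_degree m" using exp by (auto simp: S_def)
    qed
    also have "(\<Sum>m\<in>keys p - S. Poly_Mapping.single m (lookup p m)) = p - t"
      by (rule poly_mapping_eqI) (auto simp: lookup_sum lookup_single when_def in_keys_iff lookup_minus look)
    finally have d: "p - t \<in> ?A" .
    have "p - t \<in> W i" using W(2) d by blast
    from ideal_diff[OF W(1) p this] have "t \<in> U i" by (auto simp: U_def in_keys_iff look split: if_splits)
    then have "t \<in> W j" using that by (auto simp: U_def)
    then have "(p - t) + t \<in> W j" using W(2) d by (intro ideal_add[OF W(1)]) auto
    then show "p \<in> W j" by simp
  qed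
  have "W i = W m" if "i \<ge> m" for i
    using WU[of i m] WU[of m i] m[OF that] by simp
  then show "\<exists>m. \<forall>i\<ge>m. J i = J m" using W(3) by metis
qed

text \<open>
  The maximal ideals of the quotient come from maximal, hence prime, ideals over \<open>A\<close>, and there
  is only one of these. The socle is spanned by the class of \<open>x\<^sub>1\<^sup>D\<close> with \<open>D = 2 (n - 2)\<close>.
\<close>

lemma gorenstein_quot_annihilator:
  assumes n: "n \<ge> 2"
  shows "gorenstein_artinian_local (mpoly_ring n Quot (annihilator n (top_weight n) :: 'a::field mpoly set))"
proof -
  let ?R = "mpoly_ring n :: 'a mpoly ring"
  let ?A = "annihilator n (top_weight n) :: 'a mpoly set"
  let ?f = "(+>\<^bsub>?R\<^esub>) ?A"
  let ?M = "?f ` origin_ideal n"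
  define s :: "'a mpoly" where "s = mon (Poly_Mapping.single 1 (2 * (n - 2)))"
  interpret R: cring ?R by (rule cring_mpoly_ring)
  have A: "ideal ?A ?R" by (rule ideal_annihilator)
  have sub: "?A \<subseteq> origin_ideal n" by (rule annihilator_subset_origin_ideal[OF n])
  have s: "s \<in> carrier ?R" unfolding s_def using n by (intro single_in_carrier) (simp add: single_in_exponents)
  have eq: "?f p = ?f q \<longleftrightarrow> p - q \<in> ?A" if "p \<in> carrier ?R" "q \<in> carrier ?R" for p q
    using R.quotient_eq_iff_same_a_r_cos[OF A that] that
    by (simp add: a_minus_def mpoly_ring_a_inv)
  have zero: "\<zero>\<^bsub>?R Quot ?A\<^esub> = ?f 0"
    using R.a_rcos_zero[OF A ideal_zero[OF A]] by (simp add: FactRing_def)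
  have mult: "?f p \<otimes>\<^bsub>?R Quot ?A\<^esub> ?f q = ?f (p * q)" if "p \<in> carrier ?R" "q \<in> carrier ?R" for p q
    using ideal.rcoset_mult_add[OF A that] by (simp add: FactRing_def)
  have origin_carrier: "q \<in> carrier ?R" if "q \<in> origin_ideal n" for q
    using that by (simp add: origin_ideal_def)
  have socle_iff: "?f p \<in> socle (?R Quot ?A) ?M \<longleftrightarrow> (\<forall>q\<in>origin_ideal n. q * p \<in> ?A)"
    if p: "p \<in> carrier ?R" for p
    using p by (auto simp: socle_def carrier_quot zero mult origin_carrier eq mult_in_carrier zero_in_carrier)
  have max: "maximalideal ?M (?R Quot ?A)"
    using R.maximalideal_quot_iff[OF A ideal_origin_ideal sub] maximalideal_origin_ideal by blast
  have unique: "M' = ?M" if "maximalideal M' (?R Quot ?A)" for M'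
  proof -
    note U = R.quot_ideal_eq_image_Union[OF A maximalideal.axioms(1)[OF that]]
    have "maximalideal (\<Union>M') ?R" using that R.maximalideal_quot_iff[OF A U(1,2)] U(3) by simp
    then have "\<Union>M' = origin_ideal n"
      using prime_over_annihilator[OF R.maximalideal_prime U(2)] by blast
    then show ?thesis using U(3) by simp
  qed
  have s_socle: "?f (r * s) \<in> socle (?R Quot ?A) ?M" if r: "r \<in> carrier ?R" for r
  proof -
    have "r * (q * s) \<in> ?A" if "q \<in> origin_ideal n" for q
      using origin_ideal_mult_socle[OF n that] unfolding s_def by (intro ideal_mult[OF A _ r])
    then show ?thesis
      unfolding socle_iff[OF mult_in_carrier[OF r s]] by (simp add: mult.left_commute)
  qed
  have "socle (?R Quot ?A) ?M = {r \<otimes>\<^bsub>?R Quot ?A\<^esub> ?f s |r. r \<in> carrier (?R Quot ?A)}"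
  proof (intro equalityI subsetI)
    fix a assume a: "a \<in> socle (?R Quot ?A) ?M"
    then obtain p where p: "p \<in> carrier ?R" "a = ?f p" by (auto simp: socle_def carrier_quot)
    let ?c = "const (linform (top_weight n) p)"
    have "p - ?c * s \<in> ?A"
      using a p(1) unfolding s_def p(2) by (intro socle_multiple_of_top_power[OF n]) (simp_all add: socle_iff)
    then have "a = ?f ?c \<otimes>\<^bsub>?R Quot ?A\<^esub> ?f s"
      using p s by (simp add: mult eq const_in_carrier mult_in_carrier)
    then show "a \<in> {r \<otimes>\<^bsub>?R Quot ?A\<^esub> ?f s |r. r \<in> carrier (?R Quot ?A)}"
      using const_in_carrier by (auto simp: carrier_quot)
  next
    fix a assume "a \<in> {r \<otimes>\<^bsub>?R Quot ?A\<^esub> ?f s |r. r \<in> carrier (?R Quot ?A)}"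
    then obtain r where "r \<in> carrier ?R" "a = ?f r \<otimes>\<^bsub>?R Quot ?A\<^esub> ?f s" by (auto simp: carrier_quot)
    then show "a \<in> socle (?R Quot ?A) ?M" using s_socle s by (simp add: mult)
  qed
  moreover have "?f s \<in> socle (?R Quot ?A) ?M" using s_socle[OF one_in_carrier] by simp
  moreover have "?f s \<noteq> \<zero>\<^bsub>?R Quot ?A\<^esub>"
    using socle_generator_not_in_annihilator[of n] s by (simp add: zero eq zero_in_carrier s_def)
  ultimately show ?thesis
    unfolding gorenstein_artinian_local_def using artinian_quot_annihilator max unique by blast
qed

theorem theorem4p2:
  fixes n :: nat
  assumes "n \<ge> 2"
  shows "homogeneous_ideal n (K_ideal n :: 'a::{alg_closed_field, field_char_0} mpoly set) \<and>
    artinian_ring (mpoly_ring n Quot (K_ideal n :: 'a mpoly set)) \<and>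
    codimension (mpoly_ring n) (K_ideal n :: 'a mpoly set) = enat n \<and>
    gorenstein_artinian_local (mpoly_ring n Quot (K_ideal n :: 'a mpoly set))"
  unfolding K_ideal_eq_annihilator[OF assms]
  by (intro conjI homogeneous_annihilator_top_weight artinian_quot_annihilator
      codimension_annihilator gorenstein_quot_annihilator assms)

end
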